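(* For any positive integers $l,m,k$ with $2\le l\le m<k$, let $H$ be the disjoint union of the complete graphs $K_l$ and $K_m$, i.e. the graph with $V(H)=V(K_l)\cup V(K_m)$ and $E(H)=E(K_l)\cup E(K_m)$, where $K_l$ and $K_m$ are vertex-disjoint. Then $H$ is $k$-Tur\'an-good.
   Context: All graphs are finite and simple. $K_r$ is the complete graph on $r$ vertices. $\mathcal{N}(H,G)$ denotes the number of copies of $H$ in $G$, i.e. the number of (not necessarily induced) subgraphs of $G$ isomorphic to $H$. A graph is $F$-free if it contains no copy of $F$ as a (not necessarily induced) subgraph. $ex(n,H,F)=\max\{\mathcal{N}(H,G): G \text{ is an } n\text{-vertex } F\text{-free graph}\}$. The Tur\'an graph $T_{k-1}(n)$ is the complete $(k-1)$-partite graph on $n$ vertices in which each class has size $\lceil n/(k-1)\rceil$ or $\lfloor n/(k-1)\rfloor$. A graph $H$ that does not contain $K_k$ as a subgraph is called $k$-Tur\'an-good if $ex(n,H,K_k)=\mathcal{N}(H,T_{k-1}(n))$ for every sufficiently large $n$. *)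

theory Defs
  imports Complex_Main "HOL-Library.Disjoint_Sets"
begin

type_synonym 'a sgraph = "'a set \<times> 'a set set"

abbreviation verts :: "'a sgraph \<Rightarrow> 'a set" where "verts \<equiv> fst"
abbreviation edges :: "'a sgraph \<Rightarrow> 'a set set" where "edges \<equiv> snd"

definition simple_graph :: "'a sgraph \<Rightarrow> bool" where
  "simple_graph G \<longleftrightarrow>
     finite (verts G) \<and> (\<forall>e \<in> edges G. e \<subseteq> verts G \<and> card e = 2)"

definition subgraph :: "'a sgraph \<Rightarrow> 'a sgraph \<Rightarrow> bool" where
  "subgraph S G \<longleftrightarrow> simple_graph S \<and> verts S \<subseteq> verts G \<and> edges S \<subseteq> edges G"

definition isomorphic :: "'a sgraph \<Rightarrow> 'b sgraph \<Rightarrow> bool" where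
  "isomorphic G H \<longleftrightarrow>
     (\<exists>f. bij_betw f (verts G) (verts H) \<and> edges H = (\<lambda>e. f ` e) ` edges G)"

definition copies :: "'b sgraph \<Rightarrow> 'a sgraph \<Rightarrow> 'a sgraph set" where
  "copies H G = {S. subgraph S G \<and> isomorphic S H}"

definition num_copies :: "'b sgraph \<Rightarrow> 'a sgraph \<Rightarrow> nat" where
  "num_copies H G = card (copies H G)"

definition free_of :: "'b sgraph \<Rightarrow> 'a sgraph \<Rightarrow> bool" where
  "free_of F G \<longleftrightarrow> copies F G = {}"

definition complete_graph :: "'a set \<Rightarrow> 'a sgraph" where
  "complete_graph A = (A, {e. e \<subseteq> A \<and> card e = 2})"

abbreviation K :: "nat \<Rightarrow> nat sgraph" where
  "K r \<equiv> complete_graph {..<r}"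

definition graph_union :: "'a sgraph \<Rightarrow> 'a sgraph \<Rightarrow> 'a sgraph" where
  "graph_union G H = (verts G \<union> verts H, edges G \<union> edges H)"

text \<open>
  Every finite graph is isomorphic to one with vertices in \<^typ>\<open>nat\<close>, so the host graphs are
  taken over that type. There are infinitely many of them on \<open>n\<close> vertices, but the set of values
  is finite (lemma \<open>finite_ex_values\<close> below), so that \<^const>\<open>Max\<close> is a genuine maximum
  whenever an \<open>F\<close>-free graph on \<open>n\<close> vertices exists.
\<close>

definition ex_num :: "nat \<Rightarrow> 'b sgraph \<Rightarrow> 'c sgraph \<Rightarrow> nat" where
  "ex_num n H F =
     Max {num_copies H G | G :: nat sgraph. simple_graph G \<and> card (verts G) = n \<and> free_of F G}"

text \<open>
  The Turan graph is determined only up to isomorphism, hence a predicate. The classes are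
  \<open>A 0, \<dots>, A (r - 1)\<close>; some of them are empty if \<open>n < r\<close>.
\<close>

definition is_turan_graph :: "nat \<Rightarrow> nat \<Rightarrow> 'a sgraph \<Rightarrow> bool" where
  "is_turan_graph r n T \<longleftrightarrow>
     finite (verts T) \<and> card (verts T) = n \<and>
     (\<exists>A :: nat \<Rightarrow> 'a set.
        disjoint_family_on A {..<r} \<and> (\<Union>i<r. A i) = verts T \<and>
        (\<forall>i<r. int (card (A i)) = \<lceil>real n / real r\<rceil> \<or> int (card (A i)) = \<lfloor>real n / real r\<rfloor>) \<and>
        edges T = {{u, v} | u v. \<exists>i<r. \<exists>j<r. i \<noteq> j \<and> u \<in> A i \<and> v \<in> A j})"

definition turan_good :: "nat \<Rightarrow> 'b sgraph \<Rightarrow> bool" where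
  "turan_good k H \<longleftrightarrow>
     free_of (K k) H \<and>
     (\<forall>\<^sub>F n in sequentially. \<forall>T :: nat sgraph.
        is_turan_graph (k - 1) n T \<longrightarrow> ex_num n H (K k) = num_copies H T)"

lemma finite_ex_values:
  "finite {num_copies H G | G :: nat sgraph. simple_graph G \<and> card (verts G) = n \<and> free_of F G}"
proof (rule finite_subset)
  show "{num_copies H G | G :: nat sgraph. simple_graph G \<and> card (verts G) = n \<and> free_of F G}
          \<subseteq> {..2 ^ n * 2 ^ (2 ^ n)}"
  proof safe
    fix V :: "nat set" and E
    assume s: "simple_graph (V, E)" and n: "n = card (verts (V, E))"
    have fin: "finite V" using s by (simp add: simple_graph_def)
    have "copies H (V, E) \<subseteq> Pow V \<times> Pow (Pow V)"
      using s by (fastforce simp: copies_def subgraph_def simple_graph_def)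
    hence "card (copies H (V, E)) \<le> card (Pow V \<times> Pow (Pow V))"
      using fin by (intro card_mono) auto
    also have "\<dots> = 2 ^ card V * 2 ^ (2 ^ card V)"
      using fin by (simp add: card_cartesian_product card_Pow)
    finally show "num_copies H (V, E) \<le> 2 ^ card (verts (V, E)) * 2 ^ (2 ^ card (verts (V, E)))"
      by (simp add: num_copies_def)
  qed
qed simp

lemma card_residue_class:
  assumes "i < r"
  shows "card {x::nat. x < n \<and> x mod r = i} = n div r + (if i < n mod r then 1 else 0)"
proof -
  have "{x. x < n \<and> x mod r = i} = (\<lambda>q. q * r + i) ` {..<n div r + (if i < n mod r then 1 else 0)}"
    (is "?L = ?f ` ?Q")
  proof (intro equalityI subsetI)
    fix x assume "x \<in> ?L"
    hence x: "x < n" "x mod r = i" by auto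
    have "x div r \<le> n div r" using x by (simp add: div_le_mono)
    moreover have "i < n mod r" if "x div r = n div r"
      using x that by (metis div_mult_mod_eq add_less_cancel_left)
    ultimately have "x div r \<in> ?Q" by (auto simp: le_less)
    moreover have "x = ?f (x div r)" using x by (metis div_mult_mod_eq)
    ultimately show "x \<in> ?f ` ?Q" by blast
  next
    fix x assume "x \<in> ?f ` ?Q"
    then obtain q where q: "x = q * r + i" "q < n div r + (if i < n mod r then 1 else 0)" by auto
    have nn: "n = n div r * r + n mod r" by simp
    have "x < n"
    proof (cases "q < n div r")
      case True
      hence "Suc q * r \<le> n div r * r" by (intro mult_le_mono1) simp
      thus ?thesis using q(1) assms nn by (simp only: mult_Suc)
    next
      case False
      hence "q = n div r" "i < n mod r" using q(2) by (auto split: if_splits)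
      thus ?thesis using q(1) nn by (metis nat_add_left_cancel_less)
    qed
    thus "x \<in> ?L" using q(1) assms by simp
  qed
  moreover have "inj_on ?f ?Q" using assms by (auto simp: inj_on_def)
  ultimately show ?thesis by (simp add: card_image)
qed

lemma is_turan_graph_exists:
  assumes "r > 0"
  shows "\<exists>T :: nat sgraph. is_turan_graph r n T"
proof -
  define A where "A i = {x::nat. x < n \<and> x mod r = i}" for i
  define E where "E = {{u, v} | u v. \<exists>i<r. \<exists>j<r. i \<noteq> j \<and> u \<in> A i \<and> v \<in> A j}"
  have fl: "\<lfloor>real n / real r\<rfloor> = int (n div r)" by (simp add: floor_divide_of_nat_eq)
  have ce: "\<lceil>real n / real r\<rceil> = int (n div r) + 1" if "0 < n mod r"
  proof -
    have "real n / real r \<notin> \<int>"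
    proof
      assume "real n / real r \<in> \<int>"
      hence "real n / real r = of_int \<lfloor>real n / real r\<rfloor>" by simp
      hence "real n = real (n div r) * real r" using assms fl by (simp add: field_simps)
      hence "n = n div r * r" by (metis of_nat_eq_iff of_nat_mult)
      thus False using that by (metis div_mult_mod_eq add_cancel_right_right less_irrefl)
    qed
    thus ?thesis using fl by (auto simp: ceiling_altdef)
  qed
  have "int (card (A i)) = \<lceil>real n / real r\<rceil> \<or> int (card (A i)) = \<lfloor>real n / real r\<rfloor>" if "i < r" for i
    using card_residue_class[OF that, of n] fl ce unfolding A_def by (cases "i < n mod r") auto
  moreover have "disjoint_family_on A {..<r}" by (auto simp: disjoint_family_on_def A_def)
  moreover have "(\<Union>i<r. A i) = {..<n}" using assms by (auto simp: A_def)
  ultimately have "is_turan_graph r n ({..<n}, E)"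
    unfolding is_turan_graph_def E_def by auto
  thus ?thesis by blast
qed

end

theory Submission
  imports Defs "HOL-Analysis.Convex"
begin

text \<open>
  Let \<open>r = k - 1\<close> and count ordered pairs of disjoint cliques of sizes \<open>l\<close> and \<open>m\<close>. Deleting an
  \<open>l\<close>-clique leaves a \<open>K k\<close>-free graph on \<open>n - l\<close> vertices, so the Moon--Moser inequalities bound the
  number of pairs by \<open>e\<close> times an explicit factor, \<open>e\<close> being the number of edges. The Turan graph has
  that factor times \<open>(1 - 1/r) n\<^sup>2 / 2 - O(1)\<close> pairs. A graph with more pairs would thus miss only
  \<open>O(1)\<close> edges of the Turan bound, hence be \<open>r\<close>-partite for large \<open>n\<close>. Among complete \<open>r\<close>-partite
  graphs the number of pairs does not decrease when a vertex is moved to a smaller class, so the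
  balanced one is optimal.
\<close>

subsection \<open>Moon--Moser inequalities for clique counts\<close>

text \<open>The size of the error shapes the proof. A relative error linear in \<open>1 / n\<close>
  would let a better graph miss a constant times \<open>n\<close> edges, enough for every vertex to
  be an endpoint of a missing cross pair; no clean representative of a class could then be found. A
  deficit independent of \<open>n\<close> touches a bounded number of vertices, fewer than the
  roughly \<open>n / r\<close> vertices of a class. Two facts make the relative error quadratic in
  \<open>1 / n\<close>. After deletion of an \<open>l\<close>-clique the upper bound involves
  \<open>(n - l) / r\<close>, which in the Turan graph is exactly the mean of the remaining class
  sizes; and deviations from a mean sum to zero. In the upper bound the \<open>l\<close>-cliques are
  compared with the edges rather than with their own maximum. This turns a statement about pairs
  into one about edges, where Fueredi's degree argument gives stability with explicit
  constants.\<close>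

definition cliques :: "'a set set \<Rightarrow> 'a set \<Rightarrow> nat \<Rightarrow> 'a set set" where
  "cliques E V j = {Q. Q \<subseteq> V \<and> card Q = j \<and> (\<forall>x\<in>Q. \<forall>y\<in>Q. x \<noteq> y \<longrightarrow> {x, y} \<in> E)}"

definition common_nbrs :: "'a set set \<Rightarrow> 'a set \<Rightarrow> 'a set \<Rightarrow> 'a set" where
  "common_nbrs E V Q = {w \<in> V - Q. \<forall>x\<in>Q. {w, x} \<in> E}"

lemma cliquesD:
  assumes "Q \<in> cliques E V j"
  shows "Q \<subseteq> V" "card Q = j" "\<And>x y. x \<in> Q \<Longrightarrow> y \<in> Q \<Longrightarrow> x \<noteq> y \<Longrightarrow> {x, y} \<in> E"
  using assms by (auto simp: cliques_def)

lemma finite_cliques: "finite V \<Longrightarrow> finite (cliques E V j)"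
  by (rule finite_subset[of _ "Pow V"]) (auto simp: cliques_def)

lemma cliques_mono: "W \<subseteq> V \<Longrightarrow> cliques E W j \<subseteq> cliques E V j"
  by (auto simp: cliques_def)

lemma cliques_0: "finite V \<Longrightarrow> cliques E V 0 = {{}}"
  by (auto simp: cliques_def dest: finite_subset)

lemma insert_clique:
  assumes "finite V" "Q \<in> cliques E V j" "w \<in> common_nbrs E V Q"
  shows "insert w Q \<in> cliques E V (Suc j)"
proof -
  have "finite Q" using assms cliquesD(1) finite_subset by metis
  thus ?thesis using assms by (auto simp: cliques_def common_nbrs_def insert_commute)
qed

text \<open>Double counting: adding \<open>w\<close> to \<open>Q\<close> turns an extension of a
  \<open>j\<close>-clique into a \<open>(j + 1)\<close>-clique with a marked vertex, and removing
  the marked vertex reverses this. The weight \<open>h\<close> is arbitrary because both the numbers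
  of extensions and their squares are summed this way.\<close>

lemma sum_common_nbrs_swap:
  fixes h :: "'a set \<Rightarrow> 'a \<Rightarrow> real"
  assumes V: "finite V"
  shows "(\<Sum>Q\<in>cliques E V j. \<Sum>w\<in>common_nbrs E V Q. h Q w) =
         (\<Sum>R\<in>cliques E V (Suc j). \<Sum>w\<in>R. h (R - {w}) w)"
proof -
  have finK: "finite (cliques E V i)" for i using finite_cliques[OF V] .
  have finE: "finite (common_nbrs E V Q)" for Q using V by (auto simp: common_nbrs_def)
  have finQ: "finite Q" if "Q \<in> cliques E V i" for Q i
    using that V by (auto simp: cliques_def dest: finite_subset)
  have "(\<Sum>Q\<in>cliques E V j. \<Sum>w\<in>common_nbrs E V Q. h Q w) =
        (\<Sum>(Q, w)\<in>(SIGMA Q:cliques E V j. common_nbrs E V Q). h Q w)"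
    using finK finE by (subst sum.Sigma) auto
  also have "\<dots> = (\<Sum>(R, w)\<in>(SIGMA R:cliques E V (Suc j). R). h (R - {w}) w)"
  proof (rule sum.reindex_bij_witness[where i = "\<lambda>(R, w). (R - {w}, w)" and j = "\<lambda>(Q, w). (insert w Q, w)"])
    fix a assume "a \<in> (SIGMA Q:cliques E V j. common_nbrs E V Q)"
    thus "(case case a of (Q, w) \<Rightarrow> (insert w Q, w) of (R, w) \<Rightarrow> (R - {w}, w)) = a"
      by (auto simp: common_nbrs_def)
    show "(case a of (Q, w) \<Rightarrow> (insert w Q, w)) \<in> (SIGMA R:cliques E V (Suc j). R)"
      using \<open>a \<in> _\<close> insert_clique[OF V] by auto
    show "(case case a of (Q, w) \<Rightarrow> (insert w Q, w) of (R, w) \<Rightarrow> h (R - {w}) w) = (case a of (Q, w) \<Rightarrow> h Q w)"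
      using \<open>a \<in> _\<close> by (auto simp: common_nbrs_def)
  next
    fix b assume b: "b \<in> (SIGMA R:cliques E V (Suc j). R)"
    thus "(case case b of (R, w) \<Rightarrow> (R - {w}, w) of (Q, w) \<Rightarrow> (insert w Q, w)) = b"
      by auto
    obtain R w where [simp]: "b = (R, w)" and R: "R \<in> cliques E V (Suc j)" "w \<in> R" using b by auto
    have "R - {w} \<in> cliques E V j" "w \<in> common_nbrs E V (R - {w})"
      using R finQ[OF R(1)] by (auto simp: cliques_def common_nbrs_def)
    thus "(case b of (R, w) \<Rightarrow> (R - {w}, w)) \<in> (SIGMA Q:cliques E V j. common_nbrs E V Q)" by simp
  qed
  also have "\<dots> = (\<Sum>R\<in>cliques E V (Suc j). \<Sum>w\<in>R. h (R - {w}) w)"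
    using finK finQ by (subst sum.Sigma) auto
  finally show ?thesis .
qed

lemma sum_card_common_nbrs:
  assumes "finite V"
  shows "(\<Sum>Q\<in>cliques E V j. real (card (common_nbrs E V Q))) = real (Suc j) * real (card (cliques E V (Suc j)))"
proof -
  have "(\<Sum>Q\<in>cliques E V j. real (card (common_nbrs E V Q))) = (\<Sum>R\<in>cliques E V (Suc j). real (card R))"
    using sum_common_nbrs_swap[OF assms, of "\<lambda>_ _. 1" E j] by simp
  also have "\<dots> = (\<Sum>R\<in>cliques E V (Suc j). real (Suc j))"
    by (intro sum.cong) (auto dest: cliquesD(2))
  finally show ?thesis by (simp add: mult.commute)
qed

text \<open>A vertex that extends \<open>R - {w}\<close> for two different \<open>w\<close> is
  adjacent to all of \<open>R\<close>, so every vertex outside \<open>common_nbrs E V R\<close> is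
  counted at most once.\<close>

lemma sum_card_common_nbrs_remove_le:
  assumes V: "finite V" and R: "R \<in> cliques E V (Suc j)"
  shows "(\<Sum>w\<in>R. real (card (common_nbrs E V (R - {w})))) \<le> real (card V) + real j * real (card (common_nbrs E V R))"
proof -
  have fR: "finite R" using R V by (auto simp: cliques_def dest: finite_subset)
  let ?n = "\<lambda>u. card {w \<in> R. u \<in> common_nbrs E V (R - {w})}"
  have le: "?n u \<le> 1 + j * of_bool (u \<in> common_nbrs E V R)" for u
  proof (cases "u \<in> common_nbrs E V R")
    case True
    have "?n u \<le> card R" using fR by (intro card_mono) auto
    thus ?thesis using True cliquesD(2)[OF R] by simp
  next
    case False
    have "w = w'" if "w \<in> {w \<in> R. u \<in> common_nbrs E V (R - {w})}" "w' \<in> {w \<in> R. u \<in> common_nbrs E V (R - {w})}" for w w'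
    proof (rule ccontr)
      assume "w \<noteq> w'"
      hence "u \<in> common_nbrs E V R" using that by (auto simp: common_nbrs_def)
      thus False using False by simp
    qed
    hence "?n u \<le> 1" using fR by (simp add: card_le_Suc0_iff_eq)
    thus ?thesis by simp
  qed
  have "(\<Sum>w\<in>R. card (common_nbrs E V (R - {w}))) = (\<Sum>w\<in>R. \<Sum>u\<in>V. of_bool (u \<in> common_nbrs E V (R - {w})))"
    using V by (intro sum.cong) (auto simp: common_nbrs_def intro!: arg_cong[where f = card])
  also have "\<dots> = (\<Sum>u\<in>V. ?n u)"
    using fR by (subst sum.swap) (auto intro!: sum.cong arg_cong[where f = card])
  also have "\<dots> \<le> (\<Sum>u\<in>V. 1 + j * of_bool (u \<in> common_nbrs E V R))" using le by (intro sum_mono) auto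
  also have "\<dots> = card V + j * card (common_nbrs E V R)"
    unfolding sum.distrib sum_distrib_left[symmetric] using V
    by (auto simp: common_nbrs_def intro!: arg_cong[where f = card])
  finally have "real (\<Sum>w\<in>R. card (common_nbrs E V (R - {w}))) \<le> real (card V + j * card (common_nbrs E V R))"
    using of_nat_mono by blast
  thus ?thesis by simp
qed

text \<open>The induction runs downwards from \<open>j = r\<close>, where no larger clique exists.
  Cauchy--Schwarz for the numbers of extensions of the \<open>j\<close>-cliques bounds the ratio of
  consecutive clique counts at \<open>j\<close> by means of the ratio at
  \<open>j + 1\<close>.\<close>

lemma moon_moser:
  assumes V: "finite V" and free: "cliques E V (Suc r) = {}" and "j \<le> r"
  shows "real r * real (Suc j) * real (card (cliques E V (Suc j)))
           \<le> real (r - j) * real (card V) * real (card (cliques E V j))"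
  using \<open>j \<le> r\<close>
proof (induction j rule: inc_induct)
  case base
  show ?case using free by simp
next
  case (step j)
  define x y z n where "x = real (card (cliques E V j))" and "y = real (card (cliques E V (Suc j)))"
    and "z = real (card (cliques E V (Suc (Suc j))))" and "n = real (card V)"
  let ?d = "\<lambda>Q. real (card (common_nbrs E V Q))"
  have rj: "real (r - j) = real r - real j" "real (r - Suc j) = real r - real j - 1"
    using step.hyps by auto
  have sq: "(\<Sum>Q\<in>cliques E V j. (?d Q)\<^sup>2) \<le> n * y + real j * (real (Suc (Suc j)) * z)"
  proof -
    have "(\<Sum>Q\<in>cliques E V j. (?d Q)\<^sup>2) = (\<Sum>Q\<in>cliques E V j. \<Sum>w\<in>common_nbrs E V Q. ?d Q)"
      by (simp add: power2_eq_square)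
    also have "\<dots> = (\<Sum>R\<in>cliques E V (Suc j). \<Sum>w\<in>R. ?d (R - {w}))"
      by (rule sum_common_nbrs_swap[OF V])
    also have "\<dots> \<le> (\<Sum>R\<in>cliques E V (Suc j). n + real j * ?d R)"
      unfolding n_def by (intro sum_mono sum_card_common_nbrs_remove_le[OF V])
    also have "\<dots> = n * y + real j * (real (Suc (Suc j)) * z)"
      by (simp add: sum.distrib sum_distrib_left[symmetric] sum_card_common_nbrs[OF V] y_def z_def)
    finally show ?thesis .
  qed
  have "(\<Sum>Q\<in>cliques E V j. ?d Q)\<^sup>2 \<le> x * (\<Sum>Q\<in>cliques E V j. (?d Q)\<^sup>2)"
    using sum_squared_le_sum_of_squares[of ?d "cliques E V j"]
    by (simp add: x_def mult.commute)
  also have "\<dots> \<le> x * (n * y + real j * (real (Suc (Suc j)) * z))"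
    using sq by (intro mult_left_mono) (auto simp: x_def)
  finally have "(real (Suc j) * y)\<^sup>2 \<le> x * (n * y + real j * (real (Suc (Suc j)) * z))"
    using sum_card_common_nbrs[OF V, of E j] by (simp add: y_def)
  hence "real r * (real (Suc j) * y)\<^sup>2 \<le> real r * (x * (n * y + real j * (real (Suc (Suc j)) * z)))"
    by (intro mult_left_mono) auto
  also have "\<dots> = x * (real r * n * y + real j * (real r * real (Suc (Suc j)) * z))"
    by (simp add: algebra_simps)
  also have "\<dots> \<le> x * (real r * n * y + real j * ((real r - real j - 1) * n * y))"
    using step.IH unfolding rj by (intro mult_left_mono add_left_mono) (auto simp: x_def y_def z_def n_def)
  \<comment> \<open>The factors collect because
    \<open>r + j * (r - j - 1) = (j + 1) * (r - j)\<close>.\<close>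
  also have "\<dots> = (real (Suc j) * y) * ((real r - real j) * n * x)"
    by (simp add: algebra_simps)
  finally have "(real (Suc j) * y) * (real r * real (Suc j) * y) \<le> (real (Suc j) * y) * ((real r - real j) * n * x)"
    by (simp add: power2_eq_square algebra_simps)
  moreover have "0 \<le> (real r - real j) * n * x" using step.hyps by (simp add: n_def x_def)
  ultimately have "real r * real (Suc j) * y \<le> (real r - real j) * n * x"
    by (cases "y = 0") (auto simp: y_def mult_le_cancel_left)
  thus ?case unfolding rj by (simp add: x_def y_def n_def)
qed

text \<open>Telescoped Moon--Moser: the number of \<open>j\<close>-cliques divided by
  \<open>(r choose j) * (n / r) ^ j\<close> does not increase with \<open>j\<close>. The product
  form remains meaningful for empty \<open>V\<close>. Taking \<open>i = 0\<close> gives an absolute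
  bound, \<open>i = 2\<close> a bound in terms of edges.\<close>

lemma cliques_ratio:
  assumes V: "finite V" and free: "cliques E V (Suc r) = {}" and "i \<le> j" "j \<le> r" "r > 0"
  shows "real (card (cliques E V j)) * real (r choose i) * (real (card V) / real r) ^ i
           \<le> real (card (cliques E V i)) * real (r choose j) * (real (card V) / real r) ^ j"
  using \<open>i \<le> j\<close> \<open>j \<le> r\<close>
proof (induction j rule: dec_induct)
  case base
  show ?case by simp
next
  case (step j)
  define \<mu> where "\<mu> = real (card V) / real r"
  have \<mu>: "real (card V) = \<mu> * real r" using \<open>r > 0\<close> by (simp add: \<mu>_def)
  have "real r * (real (Suc j) * real (card (cliques E V (Suc j)))) \<le> real r * (real (r - j) * \<mu> * real (card (cliques E V j)))"
    using moon_moser[OF V free, of j] step.prems unfolding \<mu> by (simp add: algebra_simps)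
  hence mm: "real (Suc j) * real (card (cliques E V (Suc j))) \<le> real (r - j) * \<mu> * real (card (cliques E V j))"
    using \<open>r > 0\<close> by (simp del: of_nat_Suc)
  have ch: "real (Suc j) * real (r choose Suc j) = real (r - j) * real (r choose j)"
    by (metis binomial_absorb_comp binomial_absorption of_nat_mult)
  have "real (Suc j) * (real (card (cliques E V (Suc j))) * real (r choose i) * \<mu> ^ i)
        \<le> real (r - j) * \<mu> * real (card (cliques E V j)) * (real (r choose i) * \<mu> ^ i)"
    using mult_right_mono[OF mm, of "real (r choose i) * \<mu> ^ i"] by (simp add: \<mu>_def mult.assoc)
  also have "\<dots> = real (r - j) * \<mu> * (real (card (cliques E V j)) * real (r choose i) * \<mu> ^ i)" by simp
  also have "\<dots> \<le> real (r - j) * \<mu> * (real (card (cliques E V i)) * real (r choose j) * \<mu> ^ j)"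
    using step by (intro mult_left_mono) (auto simp: \<mu>_def)
  also have "\<dots> = (real (r - j) * real (r choose j)) * (real (card (cliques E V i)) * \<mu> ^ Suc j)"
    by (simp add: algebra_simps)
  also have "\<dots> = real (Suc j) * (real (card (cliques E V i)) * real (r choose Suc j) * \<mu> ^ Suc j)"
    unfolding ch[symmetric] by (simp add: algebra_simps)
  finally show ?case unfolding \<mu>_def by (subst (asm) mult_le_cancel_left_pos) auto
qed

subsection \<open>Graphs with almost as many edges as the Turan graph\<close>

text \<open>\<open>E\<close> is an arbitrary set of sets and may contain \<open>{x, x}\<close>, so
  loops are excluded explicitly.\<close>

definition adj :: "'a set set \<Rightarrow> 'a \<Rightarrow> 'a \<Rightarrow> bool" where
  "adj E x y \<longleftrightarrow> x \<noteq> y \<and> {x, y} \<in> E"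

text \<open>Pairs are ordered: for \<open>X = Y\<close> every edge counts twice, and a degree sum is
  itself a \<open>cnt\<close>.\<close>

definition cnt :: "'a set \<Rightarrow> 'a set \<Rightarrow> ('a \<Rightarrow> 'a \<Rightarrow> bool) \<Rightarrow> real" where
  "cnt X Y P = (\<Sum>x\<in>X. \<Sum>y\<in>Y. of_bool (P x y))"

lemma adj_commute: "adj E x y \<longleftrightarrow> adj E y x"
  by (auto simp: adj_def insert_commute)

lemma cnt_nonneg: "cnt X Y P \<ge> 0"
  by (simp add: cnt_def sum_nonneg)

lemma cnt_cong:
  "(\<And>x y. x \<in> X \<Longrightarrow> y \<in> Y \<Longrightarrow> P x y \<longleftrightarrow> Q x y) \<Longrightarrow> cnt X Y P = cnt X Y Q"
  unfolding cnt_def by (intro sum.cong) auto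

lemma cnt_swap:
  assumes "\<And>x y. P x y \<longleftrightarrow> P y x"
  shows "cnt X Y P = cnt Y X P"
proof -
  have "P = (\<lambda>x y. P y x)" using assms by (intro ext) metis
  hence "cnt X Y P = cnt X Y (\<lambda>x y. P y x)" by simp
  thus ?thesis unfolding cnt_def by (subst (asm) (2) sum.swap) simp
qed

lemma cnt_split_right:
  assumes "finite X" "finite Y" "X \<inter> Y = {}"
  shows "cnt Z (X \<union> Y) P = cnt Z X P + cnt Z Y P"
  unfolding cnt_def sum.distrib[symmetric] by (intro sum.cong refl sum.union_disjoint assms)

lemma cnt_split_left:
  assumes "finite X" "finite Y" "X \<inter> Y = {}"
  shows "cnt (X \<union> Y) Z P = cnt X Z P + cnt Y Z P"
  unfolding cnt_def by (intro sum.union_disjoint assms)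

lemma cnt_split:
  assumes "finite X" "finite Y" "X \<inter> Y = {}" "\<And>x y. P x y \<longleftrightarrow> P y x"
  shows "cnt (X \<union> Y) (X \<union> Y) P = cnt X X P + 2 * cnt X Y P + cnt Y Y P"
  using cnt_swap[OF assms(4), of Y X]
  by (simp add: cnt_split_left[OF assms(1-3)] cnt_split_right[OF assms(1-3)])

lemma cnt_adj:
  assumes "finite V"
  shows "cnt X V (adj E) = (\<Sum>x\<in>X. real (card (common_nbrs E V {x})))"
  unfolding cnt_def
proof (intro sum.cong refl)
  fix x
  have "(\<Sum>y\<in>V. of_bool (adj E x y)) = real (card (V \<inter> {y. adj E x y}))"
    using assms by simp
  also have "V \<inter> {y. adj E x y} = common_nbrs E V {x}"
    by (auto simp: common_nbrs_def adj_def insert_commute)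
  finally show "(\<Sum>y\<in>V. of_bool (adj E x y)) = real (card (common_nbrs E V {x}))" .
qed

lemma cnt_adj_cliques:
  assumes "finite V"
  shows "cnt V V (adj E) = 2 * real (card (cliques E V 2))"
proof -
  have "cliques E V (Suc 0) = (\<lambda>x. {x}) ` V"
    by (auto simp: cliques_def card_1_singleton_iff)
  hence "(\<Sum>Q\<in>cliques E V (Suc 0). real (card (common_nbrs E V Q))) = (\<Sum>x\<in>V. real (card (common_nbrs E V {x})))"
    by (simp add: sum.reindex)
  thus ?thesis using sum_card_common_nbrs[OF assms, of E "Suc 0"] by (simp add: cnt_adj[OF assms] numeral_2_eq_2)
qed

text \<open>Fueredi's argument: the non-neighbours of a vertex of maximum degree form one class, and the
  neighbourhood is partitioned by induction.\<close>

lemma furedi_partition: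
  assumes "finite V" "cliques E V (Suc r) = {}"
  shows "\<exists>c :: 'a \<Rightarrow> nat. (\<forall>v\<in>V. c v < r) \<and>
           cnt V V (adj E) + cnt V V (\<lambda>x y. adj E x y \<and> c x = c y) \<le> cnt V V (\<lambda>x y. c x \<noteq> c y)"
  using assms
proof (induction r arbitrary: V)
  case 0
  have "{v} \<in> cliques E V (Suc 0)" if "v \<in> V" for v using that by (simp add: cliques_def)
  hence "V = {}" using 0 by blast
  thus ?case by (simp add: cnt_def)
next
  case (Suc r)
  show ?case
  proof (cases "V = {}")
    case True
    thus ?thesis by (simp add: cnt_def)
  next
    case False
    obtain x where x: "x \<in> V" and mx: "card (common_nbrs E V {x}) = Max ((\<lambda>v. card (common_nbrs E V {v})) ` V)"
      using Max_in[of "(\<lambda>v. card (common_nbrs E V {v})) ` V"] Suc.prems(1) False by fastforce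
    define N where "N = common_nbrs E V {x}"
    define W where "W = V - N"
    have max: "card (common_nbrs E V {v}) \<le> card N" if "v \<in> V" for v
      unfolding N_def mx using Suc.prems(1) that by simp
    have NV: "N \<subseteq> V" by (auto simp: N_def common_nbrs_def)
    have fin: "finite N" "finite W" using Suc.prems(1) NV by (auto simp: W_def dest: finite_subset)
    have disj: "W \<inter> N = {}" and V: "V = W \<union> N" using NV by (auto simp: W_def)
    have "cliques E N (Suc r) = {}"
    proof (rule ccontr)
      assume "cliques E N (Suc r) \<noteq> {}"
      then obtain Q where Q: "Q \<in> cliques E N (Suc r)" by blast
      have "x \<in> common_nbrs E V Q" using cliquesD(1)[OF Q] x False by (auto simp: common_nbrs_def N_def insert_commute)
      moreover have "Q \<in> cliques E V (Suc r)" using Q cliques_mono[OF NV] by blast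
      ultimately show False using insert_clique[OF Suc.prems(1)] Suc.prems(2) by blast
    qed
    then obtain c :: "'a \<Rightarrow> nat" where c: "\<forall>v\<in>N. c v < r"
      and le: "cnt N N (adj E) + cnt N N (\<lambda>x y. adj E x y \<and> c x = c y) \<le> cnt N N (\<lambda>x y. c x \<noteq> c y)"
      using Suc.IH[OF fin(1)] by blast
    define c' where "c' v = (if v \<in> N then c v else r)" for v
    have c': "c' v = c v" if "v \<in> N" for v using that by (simp add: c'_def)
    have c'r: "c' v = r" if "v \<in> W" for v using that disj by (auto simp: c'_def)
    have WN: "c' w \<noteq> c' v" if "w \<in> W" "v \<in> N" for w v using that c c' c'r by auto
    \<comment> \<open>This degree sum sees every edge inside \<open>W\<close> twice. When the bound
      is doubled, one copy of \<open>cnt W W (adj E)\<close> is left over beyond the share of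
      \<open>cnt V V (adj E)\<close>, and it pays for the edges that become monochromatic in the new
      class.\<close>
    have "cnt W V (adj E) = (\<Sum>v\<in>W. real (card (common_nbrs E V {v})))"
      by (rule cnt_adj[OF Suc.prems(1)])
    also have "\<dots> \<le> (\<Sum>v\<in>W. real (card N))" using max by (intro sum_mono) (auto simp: W_def)
    finally have deg: "cnt W W (adj E) + cnt W N (adj E) \<le> real (card W) * real (card N)"
      using cnt_split_right[OF fin(2,1) disj, of W "adj E"] V by simp
    have m: "cnt W W (\<lambda>x y. adj E x y \<and> c' x = c' y) = cnt W W (adj E)"
      "cnt W N (\<lambda>x y. adj E x y \<and> c' x = c' y) = cnt W N (\<lambda>x y. False)"
      "cnt N N (\<lambda>x y. adj E x y \<and> c' x = c' y) = cnt N N (\<lambda>x y. adj E x y \<and> c x = c y)"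
      using WN by (auto intro!: cnt_cong simp: c' c'r)
    have k: "cnt W W (\<lambda>x y. c' x \<noteq> c' y) = cnt W W (\<lambda>x y. False)"
      "cnt W N (\<lambda>x y. c' x \<noteq> c' y) = cnt W N (\<lambda>x y. True)"
      "cnt N N (\<lambda>x y. c' x \<noteq> c' y) = cnt N N (\<lambda>x y. c x \<noteq> c y)"
      using WN by (auto intro!: cnt_cong simp: c' c'r)
    have z: "cnt W W (\<lambda>x y. False) = 0" "cnt W N (\<lambda>x y. False) = 0"
      "cnt W N (\<lambda>x y. True) = real (card W) * real (card N)"
      by (auto simp: cnt_def)
    note spl = cnt_split[OF fin(2,1) disj, folded V]
    have "cnt V V (adj E) + cnt V V (\<lambda>x y. adj E x y \<and> c' x = c' y) \<le> cnt V V (\<lambda>x y. c' x \<noteq> c' y)"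
      using spl[of "adj E"] spl[of "\<lambda>x y. adj E x y \<and> c' x = c' y"] spl[of "\<lambda>x y. c' x \<noteq> c' y"]
        adj_commute[of E] deg le m k z by fastforce
    moreover have "\<forall>v\<in>V. c' v < Suc r" using c by (auto simp: c'_def less_Suc_eq)
    ultimately show ?thesis by blast
  qed
qed

lemma cnt_cross:
  fixes c :: "'a \<Rightarrow> nat"
  assumes "finite V" "\<forall>v\<in>V. c v < r"
  shows "cnt V V (\<lambda>x y. c x \<noteq> c y) = real (card V) ^ 2 - (\<Sum>i<r. real (card {v\<in>V. c v = i}) ^ 2)"
    and "(\<Sum>i<r. real (card {v\<in>V. c v = i})) = real (card V)"
proof -
  have gr: "(\<Sum>i<r. sum f {v\<in>V. c v = i}) = sum f V" for f :: "'a \<Rightarrow> real"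
    using assms by (intro sum.group) auto
  show "(\<Sum>i<r. real (card {v\<in>V. c v = i})) = real (card V)"
    using gr[of "\<lambda>_. 1"] by simp
  have "(\<Sum>i<r. real (card {v\<in>V. c v = i}) ^ 2) = (\<Sum>i<r. \<Sum>x\<in>{v\<in>V. c v = i}. real (card {v\<in>V. c v = c x}))"
    by (intro sum.cong) (auto simp: power2_eq_square)
  also have "\<dots> = (\<Sum>x\<in>V. real (card {v\<in>V. c v = c x}))" by (rule gr)
  also have "\<dots> = real (card V) ^ 2 - cnt V V (\<lambda>x y. c x \<noteq> c y)"
  proof -
    have "real (card {v\<in>V. c v = c x}) = real (card V) - (\<Sum>y\<in>V. of_bool (c x \<noteq> c y))" for x
    proof -
      have "real (card V) = (\<Sum>y\<in>V. 1)" by simp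
      also have "\<dots> = (\<Sum>y\<in>V. of_bool (c x \<noteq> c y) + of_bool (c y = c x))"
        by (intro sum.cong) auto
      also have "\<dots> = (\<Sum>y\<in>V. of_bool (c x \<noteq> c y)) + real (card {v\<in>V. c v = c x})"
        using assms(1) by (simp add: sum.distrib Int_def conj_commute)
      finally show ?thesis by simp
    qed
    thus ?thesis by (simp add: cnt_def sum_subtractf power2_eq_square)
  qed
  finally show "cnt V V (\<lambda>x y. c x \<noteq> c y) = real (card V) ^ 2 - (\<Sum>i<r. real (card {v\<in>V. c v = i}) ^ 2)"
    by simp
qed

text \<open>If two vertices of one class were adjacent, then adding from every other class a vertex that
  misses no vertex outside its class would complete a clique on \<open>r + 1\<close> vertices.\<close>

lemma proper_colouring:
  fixes C :: real
  assumes V: "finite V" and free: "cliques E V (Suc r) = {}" and r: "r > 0"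
    and C: "C \<ge> 1" "3 * C < real (card V) / real r"
    and e: "cnt V V (adj E) \<ge> (1 - 1 / real r) * real (card V) ^ 2 - C"
  shows "\<exists>c :: 'a \<Rightarrow> nat. (\<forall>v\<in>V. c v < r) \<and> (\<forall>x\<in>V. \<forall>y\<in>V. adj E x y \<longrightarrow> c x \<noteq> c y)"
proof -
  obtain c :: "'a \<Rightarrow> nat" where c: "\<forall>v\<in>V. c v < r"
    and le: "cnt V V (adj E) + cnt V V (\<lambda>x y. adj E x y \<and> c x = c y) \<le> cnt V V (\<lambda>x y. c x \<noteq> c y)"
    using furedi_partition[OF V free] by blast
  define n where "n = real (card V)"
  define a where "a i = real (card {v\<in>V. c v = i})" for i
  define B where "B = {x\<in>V. \<exists>y\<in>V. c x \<noteq> c y \<and> \<not> adj E x y}"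
  note cr = cnt_cross[OF V c, folded a_def n_def]
  have dev: "(\<Sum>i<r. (a i - n / r) ^ 2) = (\<Sum>i<r. a i ^ 2) - n ^ 2 / r"
  proof -
    have "(\<Sum>i<r. (a i - n / r) ^ 2) = (\<Sum>i<r. a i ^ 2 - 2 * (n / r) * a i + (n / r) ^ 2)"
      by (intro sum.cong) (auto simp: power2_eq_square algebra_simps)
    also have "\<dots> = (\<Sum>i<r. a i ^ 2) - 2 * (n / r) * n + r * (n / r) ^ 2"
      using cr(2) by (simp only: sum.distrib sum_subtractf sum_distrib_left[symmetric]) simp
    also have "\<dots> = (\<Sum>i<r. a i ^ 2) - n ^ 2 / r" using r by (simp add: power2_eq_square field_simps)
    finally show ?thesis .
  qed
  have pos: "(\<Sum>i<r. (a i - n / r) ^ 2) \<ge> 0" by (intro sum_nonneg) auto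
  have e': "cnt V V (adj E) \<ge> n ^ 2 - n ^ 2 / r - C" using e by (simp add: n_def algebra_simps)
  \<comment> \<open>The squared deviations add up to the loss of the complete multipartite graph
    against \<open>n ^ 2 - n ^ 2 / r\<close>, which is at most \<open>C\<close>. As
    \<open>C \<ge> 1\<close>, each deviation is at most \<open>C\<close>, and
    \<open>n / r > 3 * C\<close> leaves more than \<open>2 * C\<close>.\<close>
  have "a i > 2 * C" if "i < r" for i
  proof -
    have "(a i - n / r) ^ 2 \<le> (\<Sum>i<r. (a i - n / r) ^ 2)"
      using that by (intro member_le_sum) auto
    also have "\<dots> \<le> C" using dev cr(1) e' le cnt_nonneg[of V V "\<lambda>x y. adj E x y \<and> c x = c y"] by linarith
    also have "\<dots> \<le> C ^ 2" using C(1) by (simp add: power2_eq_square)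
    finally have "\<bar>a i - n / r\<bar> \<le> C" using C(1) by (simp add: abs_le_square_iff[symmetric])
    thus ?thesis using C(2) by (simp add: n_def)
  qed
  \<comment> \<open>The missing cross pairs number cross pairs minus adjacent pairs, plus
    monochromatic adjacent pairs. The difference is at most \<open>C\<close>, and by
    \<open>le\<close> so is the last term.\<close>
  moreover have "real (card B) \<le> 2 * C"
  proof -
    have "real (card B) = (\<Sum>x\<in>B. 1)" by simp
    also have "\<dots> \<le> (\<Sum>x\<in>B. \<Sum>y\<in>V. of_bool (c x \<noteq> c y \<and> \<not> adj E x y))"
    proof (intro sum_mono)
      fix x assume "x \<in> B"
      then obtain y where "y \<in> V" "c x \<noteq> c y \<and> \<not> adj E x y" by (auto simp: B_def)
      thus "(1::real) \<le> (\<Sum>y\<in>V. of_bool (c x \<noteq> c y \<and> \<not> adj E x y))"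
        using member_le_sum[OF \<open>y \<in> V\<close>, of "\<lambda>y. of_bool (c x \<noteq> c y \<and> \<not> adj E x y) :: real"] V by simp
    qed
    also have "\<dots> \<le> cnt V V (\<lambda>x y. c x \<noteq> c y \<and> \<not> adj E x y)"
      unfolding cnt_def using V by (intro sum_mono2) (auto simp: B_def intro!: sum_nonneg)
    also have "\<dots> = cnt V V (\<lambda>x y. c x \<noteq> c y) - cnt V V (adj E) + cnt V V (\<lambda>x y. adj E x y \<and> c x = c y)"
      unfolding cnt_def sum_subtractf[symmetric] sum.distrib[symmetric]
      by (intro sum.cong refl) (auto simp: of_bool_def)
    also have "\<dots> \<le> 2 * C" using le cr(1) dev pos e' by linarith
    finally show ?thesis .
  qed
  ultimately have big: "card B < card {v\<in>V. c v = i}" if "i < r" for i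
    using that unfolding a_def by (metis le_less_trans of_nat_less_iff)
  have fB: "finite B" using V by (simp add: B_def)
  have "\<exists>v. v \<in> V \<and> c v = i \<and> v \<notin> B" if "i < r" for i
  proof (rule ccontr)
    assume "\<not> ?thesis"
    hence "card {v\<in>V. c v = i} \<le> card B" using fB by (intro card_mono) auto
    thus False using big[OF that] by simp
  qed
  then obtain w where w: "\<And>i. i < r \<Longrightarrow> w i \<in> V \<and> c (w i) = i \<and> w i \<notin> B" by metis
  have wadj: "adj E (w i) v" if "i < r" "v \<in> V" "c v \<noteq> i" for i v
    using w[OF that(1)] that by (auto simp: B_def)
  have "c x \<noteq> c y" if xy: "x \<in> V" "y \<in> V" "adj E x y" for x y
  proof
    assume eq: "c x = c y"
    define I where "I = {..<r} - {c x}"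
    have wI: "w i \<in> V" "c (w i) = i" "i < r" "i \<noteq> c x" if "i \<in> I" for i using that w by (auto simp: I_def)
    have cx: "c x < r" using c xy(1) by blast
    have "inj_on w I" using wI by (intro inj_onI) metis
    hence cI: "card (w ` I) = r - 1" using cx by (simp add: card_image I_def)
    have notin: "x \<notin> w ` I" "y \<notin> w ` I" using wI eq by (metis imageE)+
    have "x \<noteq> y" using xy(3) by (simp add: adj_def)
    hence "card (insert x (insert y (w ` I))) = Suc r"
      using notin cI r by (simp add: I_def)
    moreover have "adj E u v" if "u \<in> insert x (insert y (w ` I))" "v \<in> insert x (insert y (w ` I))" "u \<noteq> v" for u v
    proof -
      have "adj E (w i) (w j)" if "i \<in> I" "j \<in> I" "i \<noteq> j" for i j
        using wadj[of i "w j"] wI[OF that(1)] wI[OF that(2)] that by auto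
      moreover have "adj E (w i) x" "adj E (w i) y" if "i \<in> I" for i
        using wadj[of i x] wadj[of i y] wI[OF that] xy eq by auto
      ultimately show ?thesis using that xy(3) adj_commute[of E] by auto
    qed
    ultimately have "insert x (insert y (w ` I)) \<in> cliques E V (Suc r)"
      using xy wI unfolding cliques_def adj_def by blast
    thus False using free by blast
  qed
  thus ?thesis using c by blast
qed

subsection \<open>Clique pairs in complete multipartite graphs\<close>

definition ksub :: "nat \<Rightarrow> nat \<Rightarrow> nat set set" where
  "ksub r l = {P. P \<subseteq> {..<r} \<and> card P = l}"

text \<open>\<open>Phi r l m a\<close> counts the pairs of disjoint cliques of sizes \<open>l\<close> and \<open>m\<close> in the complete
  \<open>r\<close>-partite graph with class sizes \<open>a i\<close>: \<open>P\<close> and \<open>Q\<close> are the sets of classes met by the two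
  cliques, and a class met by both contributes \<open>a i * (a i - 1)\<close>.\<close>

definition wt :: "bool \<Rightarrow> bool \<Rightarrow> real \<Rightarrow> real" where
  "wt p q x = (if p then x else 1) * (if q then x - of_bool p else 1)"

definition Phi :: "nat \<Rightarrow> nat \<Rightarrow> nat \<Rightarrow> (nat \<Rightarrow> nat) \<Rightarrow> real" where
  "Phi r l m a = (\<Sum>P\<in>ksub r l. \<Sum>Q\<in>ksub r m. \<Prod>i<r. wt (i \<in> P) (i \<in> Q) (real (a i)))"

lemma finite_ksub: "finite (ksub r l)"
  by (rule finite_subset[of _ "Pow {..<r}"]) (auto simp: ksub_def)

lemma ksubD: "P \<in> ksub r l \<Longrightarrow> finite P \<and> P \<subseteq> {..<r} \<and> card P = l"
  by (auto simp: ksub_def dest: finite_subset)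

lemma card_ksub: "card (ksub r l) = r choose l"
  using n_subsets[of "{..<r}" l] by (simp add: ksub_def)

lemma wt_nonneg: "wt p q (real n) \<ge> 0"
  by (cases n) (auto simp: wt_def)

text \<open>A single summand of \<open>Phi\<close> need not grow when a vertex moves from a class of size \<open>x\<close> to one of
  size \<open>y < x\<close>; the four summands obtained by exchanging the two classes in \<open>P\<close> and in \<open>Q\<close> grow
  together.\<close>

lemma wt_four_sum_le:
  fixes x y :: nat
  assumes "x > y"
  shows "wt p q (real x) * wt p' q' (real y) + wt p' q (real x) * wt p q' (real y)
       + wt p q' (real x) * wt p' q (real y) + wt p' q' (real x) * wt p q (real y)
     \<le> wt p q (real (x - 1)) * wt p' q' (real (y + 1)) + wt p' q (real (x - 1)) * wt p q' (real (y + 1))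
       + wt p q' (real (x - 1)) * wt p' q (real (y + 1)) + wt p' q' (real (x - 1)) * wt p q (real (y + 1))"
proof -
  define Y where "Y = real y"
  define d where "d = real (x - y - 1)"
  have x: "real x = Y + d + 1" "real (x - 1) = Y + d" "real (y + 1) = Y + 1" "real y = Y"
    using assms by (auto simp: Y_def d_def)
  have nn: "Y \<ge> 0" "d \<ge> 0" "Y * d \<ge> 0" "Y * Y \<ge> 0" by (auto simp: Y_def d_def)
  \<comment> \<open>Integrality enters here. If exactly three of the four flags hold, the gain is
    \<open>2 * (x + y - 2) * (x - y - 1)\<close>, which for \<open>y = 0\<close> equals
    \<open>2 * (d * d - d)\<close>.\<close>
  have "d * d \<ge> d"
  proof (cases "x - y - 1")
    case (Suc k)
    hence "d \<ge> 1" by (simp add: d_def)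
    thus ?thesis by simp
  qed (simp add: d_def)
  moreover have "Y * (Y * d) \<ge> 0" "Y * (d * d) \<ge> 0" using nn by auto
  ultimately show ?thesis
    unfolding x wt_def using nn
    by (cases p; cases q; cases p'; cases q';
        simp only: if_True if_False of_bool_eq diff_0_right mult_1_left mult_1_right;
        simp only: algebra_simps; linarith)
qed

lemma Phi_move:
  assumes p: "p < r" and q: "q < r" and a: "a p > a q"
  shows "Phi r l m a \<le> Phi r l m (a(p := a p - 1, q := a q + 1))"
proof -
  have pq: "p \<noteq> q" using a by auto
  define s where "s = id(p := q, q := p)"
  define F where "F b P Q = (\<Prod>i<r. wt (i \<in> P) (i \<in> Q) (real (b i)))" for b :: "nat \<Rightarrow> nat" and P Q
  define a' where "a' = a(p := a p - 1, q := a q + 1)"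
  have ss: "s (s i) = i" for i using pq by (auto simp: s_def)
  have sP: "s ` s ` P = P" for P by (auto simp: image_image ss)
  have sr: "s ` P \<in> ksub r k" if "P \<in> ksub r k" for P k
  proof -
    have "inj s" using ss by (metis injI)
    hence "card (s ` P) = card P" by (metis card_image inj_on_subset subset_UNIV)
    thus ?thesis using that p q by (auto simp: ksub_def s_def)
  qed
  have re: "(\<Sum>P\<in>ksub r k. f (s ` P)) = (\<Sum>P\<in>ksub r k. f P)" for f :: "nat set \<Rightarrow> real" and k
    by (rule sum.reindex_bij_witness[of _ "image s" "image s"]) (auto simp: sP sr)
  \<comment> \<open>Exchanging \<open>p\<close> and \<open>q\<close> permutes
    \<open>ksub r l\<close> and \<open>ksub r m\<close>, so each of the four sums equals
    \<open>Phi\<close>.\<close>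
  have four: "4 * Phi r l m b = (\<Sum>P\<in>ksub r l. \<Sum>Q\<in>ksub r m.
      F b P Q + F b (s ` P) Q + F b P (s ` Q) + F b (s ` P) (s ` Q))" for b
  proof -
    have Phi: "Phi r l m b = (\<Sum>P\<in>ksub r l. \<Sum>Q\<in>ksub r m. F b P Q)" by (simp add: Phi_def F_def)
    have "(\<Sum>P\<in>ksub r l. \<Sum>Q\<in>ksub r m. F b (s ` P) Q) = Phi r l m b"
      using re[of "\<lambda>P. \<Sum>Q\<in>ksub r m. F b P Q" l] by (simp add: Phi)
    moreover have "(\<Sum>P\<in>ksub r l. \<Sum>Q\<in>ksub r m. F b P (s ` Q)) = Phi r l m b"
      using re[of "F b _" m] by (simp add: Phi)
    moreover have "(\<Sum>P\<in>ksub r l. \<Sum>Q\<in>ksub r m. F b (s ` P) (s ` Q)) = Phi r l m b"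
      using re[of "\<lambda>P. \<Sum>Q\<in>ksub r m. F b P Q" l] re[of "F b _" m] by (simp add: Phi)
    ultimately show ?thesis by (simp add: sum.distrib Phi)
  qed
  have F: "F b P Q = wt (p \<in> P) (p \<in> Q) (real (b p)) * wt (q \<in> P) (q \<in> Q) (real (b q)) *
      (\<Prod>i\<in>{..<r} - {p} - {q}. wt (i \<in> P) (i \<in> Q) (real (b i)))" for b P Q
    unfolding F_def using p q pq
    by (subst prod.remove[of _ p], simp, simp, subst prod.remove[of _ q]) (auto simp: mult.assoc)
  have mem: "p \<in> s ` P \<longleftrightarrow> q \<in> P" "q \<in> s ` P \<longleftrightarrow> p \<in> P" "i \<noteq> p \<Longrightarrow> i \<noteq> q \<Longrightarrow> i \<in> s ` P \<longleftrightarrow> i \<in> P" for P i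
    using pq by (auto simp: s_def image_iff split: if_splits)
  have "F a P Q + F a (s ` P) Q + F a P (s ` Q) + F a (s ` P) (s ` Q)
      \<le> F a' P Q + F a' (s ` P) Q + F a' P (s ` Q) + F a' (s ` P) (s ` Q)" for P Q
  proof -
    define R where "R = (\<Prod>i\<in>{..<r} - {p} - {q}. wt (i \<in> P) (i \<in> Q) (real (a i)))"
    have R: "(\<Prod>i\<in>{..<r} - {p} - {q}. wt (i \<in> P') (i \<in> Q') (real (b i))) = R"
      if "P' = P \<or> P' = s ` P" "Q' = Q \<or> Q' = s ` Q" "b = a \<or> b = a'" for P' Q' b
      unfolding R_def using that by (intro prod.cong) (auto simp: mem a'_def)
    have "R \<ge> 0" unfolding R_def by (intro prod_nonneg) (auto simp: wt_nonneg)
    have a': "a' p = a p - 1" "a' q = a q + 1" using pq by (auto simp: a'_def)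
    show ?thesis
      unfolding F mem using mult_right_mono[OF wt_four_sum_le[OF a, of "p \<in> P" "p \<in> Q" "q \<in> P" "q \<in> Q"] \<open>R \<ge> 0\<close>]
      by (simp add: R a' distrib_right)
  qed
  hence "4 * Phi r l m a \<le> 4 * Phi r l m a'" unfolding four by (intro sum_mono)
  thus ?thesis by (simp add: a'_def)
qed

text \<open>Induction on the distance \<open>\<Sum>i<r. \<bar>a i - t i\<bar>\<close>. Equal sums
  provide \<open>p\<close> with \<open>a p > t p\<close> and \<open>q\<close> with
  \<open>a q < t q\<close>; balance gives \<open>a p \<ge> t p + 1 \<ge> t q > a q\<close>, so a
  vertex may move from \<open>p\<close> to \<open>q\<close>, which brings \<open>a\<close> closer to
  \<open>t\<close>.\<close>

lemma Phi_le_balanced: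
  assumes "(\<Sum>i<r. a i) = (\<Sum>i<r. t i)" and bal: "\<And>i j. i < r \<Longrightarrow> j < r \<Longrightarrow> t i \<le> t j + 1"
  shows "Phi r l m a \<le> Phi r l m t"
  using assms(1)
proof (induction "\<Sum>i<r. nat \<bar>int (a i) - int (t i)\<bar>" arbitrary: a rule: less_induct)
  case less
  show ?case
  proof (cases "\<forall>i<r. a i = t i")
    case True
    hence "Phi r l m a = Phi r l m t" unfolding Phi_def by (intro sum.cong prod.cong) auto
    thus ?thesis by simp
  next
    case False
    have "\<exists>p<r. a p > t p"
    proof (rule ccontr)
      assume "\<not> ?thesis"
      hence le: "\<forall>i\<in>{..<r}. a i \<le> t i" by (metis lessThan_iff not_less)
      moreover have "\<exists>i\<in>{..<r}. a i < t i" using False le by (metis lessThan_iff le_neq_implies_less)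
      ultimately have "(\<Sum>i<r. a i) < (\<Sum>i<r. t i)" by (intro sum_strict_mono_ex1) auto
      thus False using less.prems by simp
    qed
    moreover have "\<exists>q<r. a q < t q"
    proof (rule ccontr)
      assume "\<not> ?thesis"
      hence le: "\<forall>i\<in>{..<r}. t i \<le> a i" by (metis lessThan_iff not_less)
      moreover have "\<exists>i\<in>{..<r}. t i < a i" using False le by (metis lessThan_iff le_neq_implies_less)
      ultimately have "(\<Sum>i<r. t i) < (\<Sum>i<r. a i)" by (intro sum_strict_mono_ex1) auto
      thus False using less.prems by simp
    qed
    ultimately obtain p q where p: "p < r" "a p > t p" and q: "q < r" "a q < t q" by blast
    define a' where "a' = a(p := a p - 1, q := a q + 1)"
    have pq: "p \<noteq> q" using p q by auto
    have gt: "a p > a q" using bal[OF q(1) p(1)] p q by linarith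
    have split: "(\<Sum>i<r. f i) = f p + f q + (\<Sum>i\<in>{..<r} - {p} - {q}. f i)" for f :: "nat \<Rightarrow> nat"
      using p(1) q(1) pq by (subst sum.remove[of _ p], simp, simp, subst sum.remove[of _ q]) auto
    have a': "a' p = a p - 1" "a' q = a q + 1" using pq by (auto simp: a'_def)
    have rest: "(\<Sum>i\<in>{..<r} - {p} - {q}. a' i) = (\<Sum>i\<in>{..<r} - {p} - {q}. a i)"
      "(\<Sum>i\<in>{..<r} - {p} - {q}. nat \<bar>int (a' i) - int (t i)\<bar>) = (\<Sum>i\<in>{..<r} - {p} - {q}. nat \<bar>int (a i) - int (t i)\<bar>)"
      by (auto intro!: sum.cong simp: a'_def)
    have "(\<Sum>i<r. a' i) = (\<Sum>i<r. a i)"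
      unfolding split[of a'] split[of a] rest a' using p by simp
    moreover have "(\<Sum>i<r. nat \<bar>int (a' i) - int (t i)\<bar>) < (\<Sum>i<r. nat \<bar>int (a i) - int (t i)\<bar>)"
      unfolding split[of "\<lambda>i. nat \<bar>int (a' i) - int (t i)\<bar>"] split[of "\<lambda>i. nat \<bar>int (a i) - int (t i)\<bar>"] rest a'
      using p q by simp
    ultimately have "Phi r l m a' \<le> Phi r l m t" using less.hyps[of a'] less.prems by simp
    thus ?thesis using Phi_move[OF p(1) q(1) gt, of l m] by (simp add: a'_def)
  qed
qed

text \<open>The cliques are chosen one after the other: for fixed \<open>P\<close> the inner sum is
  the elementary symmetric polynomial of degree \<open>m\<close> in the class sizes, lowered by one
  on \<open>P\<close>. Both the exact count and the lower estimate for the Turan graph use this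
  form.\<close>

lemma Phi_alt:
  "Phi r l m a = (\<Sum>P\<in>ksub r l. (\<Prod>i\<in>P. real (a i)) *
     (\<Sum>Q\<in>ksub r m. \<Prod>i\<in>Q. real (a i) - of_bool (i \<in> P)))"
proof -
  have sub: "(\<Prod>i<r. if i \<in> P then f i else 1) = prod f P" if "P \<in> ksub r k" for P k and f :: "nat \<Rightarrow> real"
    using ksubD[OF that] by (simp add: prod.If_cases Int_absorb1)
  have "(\<Prod>i<r. wt (i \<in> P) (i \<in> Q) (real (a i))) = (\<Prod>i\<in>P. real (a i)) * (\<Prod>i\<in>Q. real (a i) - of_bool (i \<in> P))"
    if "P \<in> ksub r l" "Q \<in> ksub r m" for P Q
    unfolding wt_def prod.distrib using sub[OF that(1), of "\<lambda>i. real (a i)"]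
      sub[OF that(2), of "\<lambda>i. real (a i) - of_bool (i \<in> P)"] by simp
  thus ?thesis unfolding Phi_def sum_distrib_left by (intro sum.cong refl) auto
qed

section \<open>Transversals of a vertex colouring\<close>

lemma card_transversals:
  fixes c :: "'a \<Rightarrow> nat"
  assumes V: "finite V" and P: "finite P"
  shows "card {L. L \<subseteq> V \<and> inj_on c L \<and> c ` L = P} = (\<Prod>i\<in>P. card {v\<in>V. c v = i})"
proof -
  let ?T = "\<Pi>\<^sub>E i\<in>P. {v\<in>V. c v = i}"
  have "bij_betw (\<lambda>f. f ` P) ?T {L. L \<subseteq> V \<and> inj_on c L \<and> c ` L = P}"
  proof (rule bij_betw_imageI)
    have cf: "c (f i) = i" "f i \<in> V" if "f \<in> ?T" "i \<in> P" for f i using PiE_mem[OF that] by auto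
    show "inj_on (\<lambda>f. f ` P) ?T"
    proof (rule inj_onI)
      fix f g assume f: "f \<in> ?T" and g: "g \<in> ?T" and eq: "f ` P = g ` P"
      have "f i = g i" if "i \<in> P" for i
      proof -
        obtain j where "j \<in> P" "f i = g j" using eq \<open>i \<in> P\<close> by blast
        thus ?thesis using cf(1)[OF f that] cf(1)[OF g] by auto
      qed
      thus "f = g" using f g by (intro PiE_ext)
    qed
    show "(\<lambda>f. f ` P) ` ?T = {L. L \<subseteq> V \<and> inj_on c L \<and> c ` L = P}"
    proof (intro equalityI subsetI)
      fix L assume "L \<in> (\<lambda>f. f ` P) ` ?T"
      then obtain f where f: "f \<in> ?T" "L = f ` P" by blast
      thus "L \<in> {L. L \<subseteq> V \<and> inj_on c L \<and> c ` L = P}"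
        using cf[OF f(1)] by (auto simp: inj_on_def image_image)
    next
      fix L assume "L \<in> {L. L \<subseteq> V \<and> inj_on c L \<and> c ` L = P}"
      hence L: "L \<subseteq> V" "inj_on c L" "c ` L = P" by auto
      define f where "f = restrict (inv_into L c) P"
      have "f \<in> ?T"
      proof (rule PiE_I)
        fix i assume "i \<in> P"
        thus "f i \<in> {v \<in> V. c v = i}" using L f_inv_into_f[of i c L] inv_into_into[of i c L]
          by (auto simp: f_def)
      qed (simp add: f_def)
      moreover have "f ` P = L" using L by (auto simp: f_def image_image)
      ultimately show "L \<in> (\<lambda>f. f ` P) ` ?T" by blast
    qed
  qed
  thus ?thesis using card_PiE[OF P, of "\<lambda>i. {v\<in>V. c v = i}"] by (simp add: bij_betw_same_card[symmetric])
qed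

text \<open>These are the \<open>l\<close>-cliques of the complete multipartite graph whose classes
  are the fibres of \<open>c\<close>.\<close>

definition transversals :: "('a \<Rightarrow> nat) \<Rightarrow> 'a set \<Rightarrow> nat \<Rightarrow> 'a set set" where
  "transversals c V l = {L. L \<subseteq> V \<and> inj_on c L \<and> card L = l}"

lemma sum_transversals:
  fixes h :: "nat set \<Rightarrow> real"
  assumes V: "finite V" and c: "\<forall>v\<in>V. c v < r"
  shows "(\<Sum>L\<in>transversals c V l. h (c ` L)) =
         (\<Sum>P\<in>ksub r l. (\<Prod>i\<in>P. real (card {v\<in>V. c v = i})) * h P)"
proof -
  have fin: "finite (transversals c V l)"
    by (rule finite_subset[of _ "Pow V"]) (use V in \<open>auto simp: transversals_def\<close>)
  have "(\<Sum>L\<in>transversals c V l. h (c ` L)) =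
        (\<Sum>P\<in>ksub r l. \<Sum>L\<in>{L\<in>transversals c V l. c ` L = P}. h (c ` L))"
    using fin c by (intro sum.group[symmetric] finite_ksub) (auto simp: transversals_def ksub_def card_image)
  also have "\<dots> = (\<Sum>P\<in>ksub r l. (\<Prod>i\<in>P. real (card {v\<in>V. c v = i})) * h P)"
  proof (intro sum.cong refl)
    fix P assume P: "P \<in> ksub r l"
    have "{L\<in>transversals c V l. c ` L = P} = {L. L \<subseteq> V \<and> inj_on c L \<and> c ` L = P}"
      using ksubD[OF P] by (auto simp: transversals_def card_image[symmetric])
    hence "real (card {L\<in>transversals c V l. c ` L = P}) = (\<Prod>i\<in>P. real (card {v\<in>V. c v = i}))"
      using card_transversals[OF V, of P c] ksubD[OF P] by (simp flip: of_nat_prod)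
    thus "(\<Sum>L\<in>{L\<in>transversals c V l. c ` L = P}. h (c ` L)) = (\<Prod>i\<in>P. real (card {v\<in>V. c v = i})) * h P"
      by simp
  qed
  finally show ?thesis .
qed

lemma card_transversal_pairs:
  assumes V: "finite V" and c: "\<forall>v\<in>V. c v < r"
  shows "real (card (SIGMA L:transversals c V l. transversals c (V - L) m)) =
         Phi r l m (\<lambda>i. card {v\<in>V. c v = i})"
proof -
  have fin: "finite (transversals c W k)" if "finite W" for W k
    by (rule finite_subset[of _ "Pow W"]) (use that in \<open>auto simp: transversals_def\<close>)
  define h where "h P = (\<Sum>Q\<in>ksub r m. \<Prod>i\<in>Q. real (card {v\<in>V. c v = i}) - of_bool (i \<in> P))" for P
  have "real (card (transversals c (V - L) m)) = h (c ` L)" if L: "L \<in> transversals c V l" for L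
  proof -
    have cls: "real (card {v\<in>V - L. c v = i}) = real (card {v\<in>V. c v = i}) - of_bool (i \<in> c ` L)" for i
    proof (cases "i \<in> c ` L")
      case True
      then obtain x where x: "x \<in> L" "i = c x" by blast
      hence "{v\<in>V - L. c v = i} = {v\<in>V. c v = i} - {x}" "x \<in> {v\<in>V. c v = i}"
        using L by (auto simp: transversals_def inj_on_def)
      moreover have "card ({v\<in>V. c v = i} - {x}) = card {v\<in>V. c v = i} - 1" "card {v\<in>V. c v = i} > 0"
        using calculation(2) V by (auto simp: card_gt_0_iff intro!: card_Diff_singleton)
      ultimately show ?thesis using True by simp
    next
      case False
      hence "{v\<in>V - L. c v = i} = {v\<in>V. c v = i}" by auto
      thus ?thesis using False by simp
    qed
    have "real (card (transversals c (V - L) m)) = (\<Sum>M\<in>transversals c (V - L) m. 1)" by simp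
    also have "\<dots> = h (c ` L)"
      using sum_transversals[of "V - L" c r "\<lambda>_. 1" m] V c unfolding h_def cls by simp
    finally show ?thesis .
  qed
  hence "real (card (SIGMA L:transversals c V l. transversals c (V - L) m)) = (\<Sum>L\<in>transversals c V l. h (c ` L))"
    using V fin by (simp add: card_SigmaI)
  also have "\<dots> = Phi r l m (\<lambda>i. card {v\<in>V. c v = i})"
    unfolding Phi_alt h_def[symmetric] by (rule sum_transversals[OF V c])
  finally show ?thesis .
qed

subsection \<open>Clique pairs in graphs of bounded clique number\<close>

lemma prod_one_plus_approx:
  fixes x :: "'i \<Rightarrow> real"
  assumes "finite Q" "0 \<le> h" "h \<le> 1" "\<And>i. i \<in> Q \<Longrightarrow> \<bar>x i\<bar> \<le> h"
  shows "\<bar>(\<Prod>i\<in>Q. 1 + x i) - 1 - (\<Sum>i\<in>Q. x i)\<bar> \<le> 4 ^ card Q * h ^ 2"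
  using assms(1,4)
proof (induction Q)
  case empty
  show ?case by simp
next
  case (insert a Q)
  define p S err where "p = (\<Prod>i\<in>Q. 1 + x i)" and "S = (\<Sum>i\<in>Q. x i)" and "err = p - 1 - S"
  have IH: "\<bar>err\<bar> \<le> 4 ^ card Q * h ^ 2" using insert by (simp add: err_def p_def S_def)
  have "\<bar>S\<bar> \<le> (\<Sum>i\<in>Q. \<bar>x i\<bar>)" unfolding S_def by (rule sum_abs)
  also have "\<dots> \<le> (\<Sum>i\<in>Q. h)" using insert.prems by (intro sum_mono) auto
  finally have S: "\<bar>S\<bar> \<le> real (card Q) * h" by simp
  have a: "\<bar>x a\<bar> \<le> h" using insert.prems by simp
  \<comment> \<open>The base 4 comes from here: \<open>h \<le> 1\<close> makes the old error at most
    double, and the new term \<open>x a * S\<close> is at most \<open>card Q * h ^ 2\<close>, hence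
    at most one more \<open>4 ^ card Q * h ^ 2\<close>.\<close>
  have "\<bar>(1 + x a) * err\<bar> \<le> 2 * (4 ^ card Q * h ^ 2)"
    unfolding abs_mult using a assms(3) IH by (intro mult_mono) auto
  moreover have "\<bar>x a * S\<bar> \<le> h * (real (card Q) * h)"
    unfolding abs_mult using a S assms(2) by (intro mult_mono) auto
  moreover have "h * (real (card Q) * h) \<le> 4 ^ card Q * h ^ 2"
  proof -
    have "card Q \<le> 4 ^ card Q" using less_exp[of "card Q"] power_mono[of 2 "4::nat" "card Q"] by linarith
    hence "real (card Q) \<le> 4 ^ card Q" by (metis of_nat_le_iff of_nat_numeral of_nat_power)
    hence "real (card Q) * h ^ 2 \<le> 4 ^ card Q * h ^ 2" by (intro mult_right_mono) auto
    thus ?thesis by (simp add: power2_eq_square mult_ac)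
  qed
  moreover have "(\<Prod>i\<in>insert a Q. 1 + x i) - 1 - (\<Sum>i\<in>insert a Q. x i) = (1 + x a) * err + x a * S"
    using insert.hyps by (simp add: err_def p_def S_def algebra_simps)
  moreover have "(0::real) \<le> 4 ^ card Q * h ^ 2" by simp
  ultimately show ?case using insert.hyps by (simp add: abs_le_iff)
qed

text \<open>The terms linear in the deviations \<open>b i - \<mu>\<close> cancel, so the relative error is quadratic in \<open>1 / \<mu>\<close>.
  A merely linear error would not suffice for the stability argument.\<close>

lemma esym_lower_bound:
  fixes b :: "nat \<Rightarrow> real"
  assumes sum: "(\<Sum>i<r. b i) = real r * \<mu>" and \<mu>: "\<mu> \<ge> 2"
    and b: "\<And>i. i < r \<Longrightarrow> \<bar>b i - \<mu>\<bar> \<le> 2"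
  shows "(\<Sum>Q\<in>ksub r m. \<Prod>i\<in>Q. b i) \<ge> real (r choose m) * \<mu> ^ m * (1 - 4 ^ m * (2 / \<mu>)\<^sup>2)"
proof -
  define x where "x i = b i / \<mu> - 1" for i
  have bx: "b i = \<mu> * (1 + x i)" for i using \<mu> by (simp add: x_def)
  have xh: "\<bar>x i\<bar> \<le> 2 / \<mu>" if "i < r" for i
  proof -
    have "x i = (b i - \<mu>) / \<mu>" using \<mu> by (simp add: x_def diff_divide_distrib)
    thus ?thesis using b[OF that] \<mu> by (simp add: abs_divide divide_right_mono)
  qed
  \<comment> \<open>By symmetry every index lies in equally many \<open>Q\<close>, so the linear
    terms add up to a multiple of \<open>\<Sum>i<r. x i = 0\<close>. Written as a difference, the
    multiplicity covers \<open>m = 0\<close> as well.\<close>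
  have cnt_i: "real (card {Q \<in> ksub r m. i \<in> Q}) = real (r choose m) - real ((r - 1) choose m)" if "i < r" for i
  proof -
    have "{Q \<in> ksub r m. i \<in> Q} = ksub r m - {Q. Q \<subseteq> {..<r} - {i} \<and> card Q = m}"
      by (auto simp: ksub_def)
    moreover have "{Q. Q \<subseteq> {..<r} - {i} \<and> card Q = m} \<subseteq> ksub r m" by (auto simp: ksub_def)
    moreover have "card {Q. Q \<subseteq> {..<r} - {i} \<and> card Q = m} = (r - 1) choose m"
      using n_subsets[of "{..<r} - {i}" m] that by simp
    ultimately show ?thesis
      using card_Diff_subset[of "{Q. Q \<subseteq> {..<r} - {i} \<and> card Q = m}" "ksub r m"]
        card_mono[OF finite_ksub, of "{Q. Q \<subseteq> {..<r} - {i} \<and> card Q = m}" r m]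
        finite_subset[OF _ finite_ksub, of _ r m] card_ksub[of r m] by auto
  qed
  have "(\<Sum>i<r. x i) = 0"
    using sum \<mu> by (simp add: x_def sum_subtractf sum_divide_distrib[symmetric])
  moreover have "(\<Sum>Q\<in>ksub r m. \<Sum>i\<in>Q. x i) = (real (r choose m) - real ((r - 1) choose m)) * (\<Sum>i<r. x i)"
  proof -
    have "(\<Sum>Q\<in>ksub r m. \<Sum>i\<in>Q. x i) = (\<Sum>Q\<in>ksub r m. \<Sum>i<r. of_bool (i \<in> Q) * x i)"
    proof (rule sum.cong[OF refl])
      fix Q assume "Q \<in> ksub r m"
      hence "{..<r} \<inter> {i. i \<in> Q} = Q" by (auto simp: ksub_def)
      thus "(\<Sum>i\<in>Q. x i) = (\<Sum>i<r. of_bool (i \<in> Q) * x i)" by simp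
    qed
    also have "\<dots> = (\<Sum>i<r. (\<Sum>Q\<in>ksub r m. of_bool (i \<in> Q)) * x i)"
      by (subst sum.swap) (simp only: sum_distrib_right)
    also have "\<dots> = (\<Sum>i<r. (real (r choose m) - real ((r - 1) choose m)) * x i)"
      using cnt_i by (intro sum.cong) (auto simp: finite_ksub Int_def)
    finally show ?thesis by (simp add: sum_distrib_left)
  qed
  ultimately have z: "(\<Sum>Q\<in>ksub r m. \<Sum>i\<in>Q. x i) = 0" by simp
  have "(\<Prod>i\<in>Q. b i) \<ge> \<mu> ^ m * (1 - 4 ^ m * (2 / \<mu>)\<^sup>2) + \<mu> ^ m * (\<Sum>i\<in>Q. x i)" if Q: "Q \<in> ksub r m" for Q
  proof -
    have "\<bar>(\<Prod>i\<in>Q. 1 + x i) - 1 - (\<Sum>i\<in>Q. x i)\<bar> \<le> 4 ^ card Q * (2 / \<mu>) ^ 2"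
      using \<mu> ksubD[OF Q] xh by (intro prod_one_plus_approx) auto
    hence "(\<Prod>i\<in>Q. 1 + x i) \<ge> 1 - 4 ^ m * (2 / \<mu>)\<^sup>2 + (\<Sum>i\<in>Q. x i)"
      using ksubD[OF Q] by (simp only: abs_le_iff) linarith
    hence "\<mu> ^ m * (\<Prod>i\<in>Q. 1 + x i) \<ge> \<mu> ^ m * (1 - 4 ^ m * (2 / \<mu>)\<^sup>2 + (\<Sum>i\<in>Q. x i))"
      using \<mu> by (intro mult_left_mono) auto
    moreover have "(\<Prod>i\<in>Q. b i) = \<mu> ^ m * (\<Prod>i\<in>Q. 1 + x i)"
      unfolding bx prod.distrib using ksubD[OF Q] by simp
    ultimately show ?thesis by (simp add: distrib_left)
  qed
  hence "(\<Sum>Q\<in>ksub r m. \<Prod>i\<in>Q. b i) \<ge>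
      (\<Sum>Q\<in>ksub r m. \<mu> ^ m * (1 - 4 ^ m * (2 / \<mu>)\<^sup>2) + \<mu> ^ m * (\<Sum>i\<in>Q. x i))"
    by (intro sum_mono)
  also have "(\<Sum>Q\<in>ksub r m. \<mu> ^ m * (1 - 4 ^ m * (2 / \<mu>)\<^sup>2) + \<mu> ^ m * (\<Sum>i\<in>Q. x i)) =
      real (r choose m) * \<mu> ^ m * (1 - 4 ^ m * (2 / \<mu>)\<^sup>2)"
    unfolding sum.distrib sum_distrib_left[symmetric] z by (simp add: card_ksub)
  finally show ?thesis .
qed

text \<open>Both elementary symmetric estimates lose at most a factor \<open>1 - \<beta>\<close>:
  the error for \<open>l\<close> and \<open>\<mu>\<close> is dominated by the one for
  \<open>m\<close> and \<open>\<mu>'\<close>, because \<open>l \<le> m\<close> and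
  \<open>\<mu>' \<le> \<mu>\<close>. The product of the two factors is at least
  \<open>1 - 2 * \<beta>\<close>.\<close>

lemma Phi_lower_bound:
  fixes t :: "nat \<Rightarrow> nat" and n r l m :: nat
  defines "\<mu> \<equiv> real n / real r" and "\<mu>' \<equiv> real (n - l) / real r"
  defines "\<beta> \<equiv> 4 ^ m * (2 / \<mu>')\<^sup>2"
  assumes lm: "l \<le> m" "m \<le> r" "l \<le> n" "r > 0"
    and sum: "(\<Sum>i<r. t i) = n" and t: "\<And>i. i < r \<Longrightarrow> \<bar>real (t i) - \<mu>\<bar> \<le> 1"
    and \<mu>': "\<mu>' \<ge> 2" and \<beta>: "\<beta> \<le> 1"
  shows "Phi r l m t \<ge> (real (r choose l) * \<mu> ^ l) * (real (r choose m) * \<mu>' ^ m) * (1 - 2 * \<beta>)"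
proof -
  have le: "\<mu>' \<le> \<mu>" unfolding \<mu>_def \<mu>'_def by (intro divide_right_mono) auto
  have n: "(\<Sum>i<r. real (t i)) = real n" using sum by (simp flip: of_nat_sum)
  have "4 ^ l * (2 / \<mu>)\<^sup>2 \<le> \<beta>"
    unfolding \<beta>_def using lm le \<mu>' by (intro mult_mono power_mono power_increasing divide_left_mono) auto
  moreover have "(\<Sum>P\<in>ksub r l. \<Prod>i\<in>P. real (t i)) \<ge> real (r choose l) * \<mu> ^ l * (1 - 4 ^ l * (2 / \<mu>)\<^sup>2)"
  proof (rule esym_lower_bound)
    show "(\<Sum>i<r. real (t i)) = real r * \<mu>" using n lm by (simp add: \<mu>_def)
    show "2 \<le> \<mu>" using le \<mu>' by simp
    show "\<bar>real (t i) - \<mu>\<bar> \<le> 2" if "i < r" for i using t[OF that] by simp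
  qed
  moreover have "real (r choose l) * \<mu> ^ l * (1 - \<beta>) \<le> real (r choose l) * \<mu> ^ l * (1 - 4 ^ l * (2 / \<mu>)\<^sup>2)"
    using calculation(1) by (intro mult_left_mono) (auto simp: \<mu>_def)
  ultimately have e: "(\<Sum>P\<in>ksub r l. \<Prod>i\<in>P. real (t i)) \<ge> real (r choose l) * \<mu> ^ l * (1 - \<beta>)"
    by linarith
  define Z where "Z = real (r choose m) * \<mu>' ^ m * (1 - \<beta>)"
  have Z: "Z \<ge> 0" using \<beta> by (simp add: Z_def \<mu>'_def)
  have h: "(\<Sum>Q\<in>ksub r m. \<Prod>i\<in>Q. real (t i) - of_bool (i \<in> P)) \<ge> Z" if P: "P \<in> ksub r l" for P
    unfolding Z_def \<beta>_def
  proof (rule esym_lower_bound)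
    have "{..<r} \<inter> {i. i \<in> P} = P" using ksubD[OF P] by auto
    hence "(\<Sum>i<r. of_bool (i \<in> P)) = real l" using ksubD[OF P] by simp
    thus "(\<Sum>i<r. real (t i) - of_bool (i \<in> P)) = real r * \<mu>'"
      using lm n by (simp add: sum_subtractf \<mu>'_def)
    show "2 \<le> \<mu>'" by fact
    fix i assume i: "i < r"
    \<comment> \<open>Removing a vertex changes the class size by 0 or 1 and the mean drops by
      \<open>l / r\<close>, between 0 and 1. The deviation therefore grows by at most 1, from 1 to
      the 2 allowed in \<open>esym_lower_bound\<close>.\<close>
    have "\<mu> - \<mu>' = real l / real r" using lm by (simp add: \<mu>_def \<mu>'_def diff_divide_distrib)
    moreover have "0 \<le> real l / real r" "real l / real r \<le> 1" using lm by auto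
    ultimately show "\<bar>real (t i) - of_bool (i \<in> P) - \<mu>'\<bar> \<le> 2"
      using t[OF i] unfolding abs_le_iff by (cases "i \<in> P"; simp only: of_bool_eq; linarith)
  qed
  have "(real (r choose l) * \<mu> ^ l) * (real (r choose m) * \<mu>' ^ m) * (1 - 2 * \<beta>)
     \<le> (real (r choose l) * \<mu> ^ l) * (real (r choose m) * \<mu>' ^ m) * (1 - \<beta>) ^ 2"
    by (intro mult_left_mono) (auto simp: power2_eq_square algebra_simps \<mu>_def \<mu>'_def)
  also have "\<dots> = (real (r choose l) * \<mu> ^ l * (1 - \<beta>)) * Z"
    by (simp add: Z_def power2_eq_square)
  also have "\<dots> \<le> (\<Sum>P\<in>ksub r l. \<Prod>i\<in>P. real (t i)) * Z" using e Z by (rule mult_right_mono)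
  also have "\<dots> = (\<Sum>P\<in>ksub r l. (\<Prod>i\<in>P. real (t i)) * Z)" by (rule sum_distrib_right)
  also have "\<dots> \<le> Phi r l m t" unfolding Phi_alt using h by (intro sum_mono mult_left_mono prod_nonneg) auto
  finally show ?thesis .
qed

section \<open>Stability for the number of clique pairs\<close>

definition clique_pairs :: "'a set set \<Rightarrow> 'a set \<Rightarrow> nat \<Rightarrow> nat \<Rightarrow> ('a set \<times> 'a set) set" where
  "clique_pairs E V l m = (SIGMA L:cliques E V l. cliques E (V - L) m)"

lemma finite_clique_pairs: "finite V \<Longrightarrow> finite (clique_pairs E V l m)"
  by (auto simp: clique_pairs_def finite_cliques)

text \<open>Only the second clique is bounded absolutely, by \<open>cliques_ratio\<close> with
  \<open>i = 0\<close> on \<open>V - L\<close>. The number of first cliques stays as a factor, to be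
  compared with the number of edges later.\<close>

lemma card_clique_pairs_le:
  assumes V: "finite V" and free: "cliques E V (Suc r) = {}" and "m \<le> r" "r > 0"
  shows "real (card (clique_pairs E V l m)) \<le>
     real (card (cliques E V l)) * (real (r choose m) * (real (card V - l) / real r) ^ m)"
proof -
  have "real (card (clique_pairs E V l m)) = (\<Sum>L\<in>cliques E V l. real (card (cliques E (V - L) m)))"
    using V by (simp add: clique_pairs_def card_SigmaI finite_cliques)
  also have "\<dots> \<le> (\<Sum>L\<in>cliques E V l. real (r choose m) * (real (card V - l) / real r) ^ m)"
  proof (intro sum_mono)
    fix L assume L: "L \<in> cliques E V l"
    have "card (V - L) = card V - l"
      using cliquesD(1,2)[OF L] V by (metis card_Diff_subset finite_subset)
    moreover have "cliques E (V - L) (Suc r) = {}" using free cliques_mono[of "V - L" V] by blast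
    ultimately show "real (card (cliques E (V - L) m)) \<le> real (r choose m) * (real (card V - l) / real r) ^ m"
      using cliques_ratio[of "V - L" E r 0 m] V assms(3,4) by (simp add: cliques_0)
  qed
  finally show ?thesis by simp
qed

text \<open>Cliques of a properly coloured graph meet every colour at most once, so they are among
  the transversals.\<close>

lemma clique_pairs_le_Phi_proper:
  fixes c :: "'a \<Rightarrow> nat"
  assumes V: "finite V" and c: "\<forall>v\<in>V. c v < r" and proper: "\<forall>x\<in>V. \<forall>y\<in>V. adj E x y \<longrightarrow> c x \<noteq> c y"
  shows "real (card (clique_pairs E V l m)) \<le> Phi r l m (\<lambda>i. card {v\<in>V. c v = i})"
proof -
  have "cliques E W k \<subseteq> transversals c W k" if "W \<subseteq> V" for W k
  proof
    fix Q assume Q: "Q \<in> cliques E W k"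
    have "x = y" if "x \<in> Q" "y \<in> Q" "c x = c y" for x y
      using that proper cliquesD(1,3)[OF Q] \<open>W \<subseteq> V\<close> unfolding adj_def by (metis subsetD)
    thus "Q \<in> transversals c W k" using cliquesD(1,2)[OF Q] by (simp add: transversals_def inj_on_def)
  qed
  hence "clique_pairs E V l m \<subseteq> (SIGMA L:transversals c V l. transversals c (V - L) m)"
    unfolding clique_pairs_def by blast
  moreover have "finite (transversals c W k)" if "W \<subseteq> V" for W k
    by (rule finite_subset[of _ "Pow V"]) (use V that in \<open>auto simp: transversals_def\<close>)
  hence "finite (SIGMA L:transversals c V l. transversals c (V - L) m)" by (intro finite_SigmaI) auto
  ultimately show ?thesis
    unfolding card_transversal_pairs[OF V c, symmetric] of_nat_le_iff by (intro card_mono)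
qed

text \<open>The constant \<open>64 * 4 ^ m * (r choose 2)\<close> is the deficit in ordered adjacent
  pairs that too many clique pairs would force. The first size condition says that
  \<open>n / r\<close> exceeds three times this deficit, as \<open>proper_colouring\<close> demands;
  the second keeps \<open>n - l\<close> at least \<open>n / 2\<close>.\<close>

lemma clique_pairs_le_Phi:
  fixes t :: "nat \<Rightarrow> nat"
  assumes V: "finite V" and free: "cliques E V (Suc r) = {}"
    and lm: "2 \<le> l" "l \<le> m" "m \<le> r"
    and sum: "(\<Sum>i<r. t i) = card V"
    and t: "\<And>i. i < r \<Longrightarrow> \<bar>real (t i) - real (card V) / real r\<bar> \<le> 1"
    and bal: "\<And>i j. i < r \<Longrightarrow> j < r \<Longrightarrow> t i \<le> t j + 1"
    and large: "3 * (64 * 4 ^ m * (r choose 2)) * r < card V" "2 * l \<le> card V"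
  shows "real (card (clique_pairs E V l m)) \<le> Phi r l m t"
proof (rule ccontr)
  assume "\<not> ?thesis"
  hence gt: "real (card (clique_pairs E V l m)) > Phi r l m t" by simp
  define n \<mu> \<mu>' \<beta> C where "n = card V" and "\<mu> = real n / real r" and "\<mu>' = real (n - l) / real r"
    and "\<beta> = 4 ^ m * (2 / \<mu>')\<^sup>2" and "C = 64 * 4 ^ m * real (r choose 2)"
  define e where "e = real (card (cliques E V 2))"
  have r: "r > 0" "r \<ge> 2" using lm by auto
  have "1 \<le> r choose 2" using zero_less_binomial[OF r(2)] by linarith
  hence "real (r choose 2) \<ge> 1" by (metis of_nat_1 of_nat_le_iff)
  moreover have "(4::real) ^ m \<ge> 1" by simp
  ultimately have C64: "C \<ge> 64 * 4 ^ m" "C \<ge> 64" unfolding C_def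
    using mult_mono[of 1 "4 ^ m" 1 "real (r choose 2)"] by auto
  have \<mu>C: "3 * C < \<mu>"
  proof -
    have "real (3 * (64 * 4 ^ m * (r choose 2)) * r) < real n" using large(1) unfolding n_def by (simp only: of_nat_less_iff)
    thus ?thesis using r by (simp add: \<mu>_def C_def field_simps)
  qed
  have \<mu>2: "\<mu> \<le> 2 * \<mu>'"
  proof -
    have "real n \<le> 2 * real (n - l)" using large(2) by (simp add: n_def)
    thus ?thesis using r by (simp add: \<mu>_def \<mu>'_def divide_right_mono)
  qed
  have \<mu>'C: "\<mu>' \<ge> C" "\<mu>' \<ge> 2" using \<mu>C \<mu>2 C64 by auto
  have \<mu>pos: "\<mu> > 0" "\<mu>' > 0" using \<mu>C \<mu>'C C64 by auto
  \<comment> \<open>That \<open>\<beta>\<close> times the square of the mean is constant expresses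
    the quadratic decay of the error; it gives \<open>\<beta> \<le> 1\<close> here and the bounded
    edge deficit below.\<close>
  have "\<beta> * \<mu>' ^ 2 = 4 * 4 ^ m" using \<mu>pos by (simp add: \<beta>_def power_divide)
  moreover have "4 * 4 ^ m \<le> \<mu>'" using C64 \<mu>'C by (smt (verit) zero_le_power)
  moreover have "\<mu>' \<le> 1 * \<mu>' ^ 2" using \<mu>'C by (simp add: power2_eq_square)
  ultimately have "\<beta> * \<mu>' ^ 2 \<le> 1 * \<mu>' ^ 2" by linarith
  hence \<beta>: "\<beta> \<le> 1" using \<mu>pos by (simp add: mult_le_cancel_right)
  define A B where "A = real (r choose l) * \<mu> ^ l" and "B = real (r choose m) * \<mu>' ^ m"
  have AB: "A > 0" "B > 0" using \<mu>pos lm by (auto simp: A_def B_def)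
  have "A * B * (1 - 2 * \<beta>) \<le> Phi r l m t"
    unfolding A_def B_def \<beta>_def \<mu>_def \<mu>'_def
    using lm large r sum t \<mu>'C \<beta> unfolding \<beta>_def \<mu>_def \<mu>'_def n_def
    by (intro Phi_lower_bound) auto
  also have "\<dots> < real (card (clique_pairs E V l m))" by (rule gt)
  also have "\<dots> \<le> real (card (cliques E V l)) * B"
    unfolding B_def \<mu>'_def n_def using card_clique_pairs_le[OF V free lm(3) r(1)] .
  finally have "A * (1 - 2 * \<beta>) * B < real (card (cliques E V l)) * B" by (simp add: mult_ac)
  hence "A * (1 - 2 * \<beta>) < real (card (cliques E V l))" using AB by (simp add: mult_less_cancel_right)
  \<comment> \<open>With the second clique cancelled, \<open>cliques_ratio\<close> from 2 to
    \<open>l\<close> trades \<open>l\<close>-cliques for edges; this is where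
    \<open>2 \<le> l\<close> enters.\<close>
  hence "A * (1 - 2 * \<beta>) * (real (r choose 2) * \<mu>\<^sup>2) \<le> real (card (cliques E V l)) * (real (r choose 2) * \<mu>\<^sup>2)"
    by (intro mult_right_mono) auto
  also have "\<dots> \<le> e * A"
    using cliques_ratio[OF V free lm(1) _ r(1)] lm unfolding A_def e_def \<mu>_def n_def by (simp add: mult.assoc)
  finally have "A * ((1 - 2 * \<beta>) * (real (r choose 2) * \<mu>\<^sup>2)) \<le> A * e" by (simp add: mult_ac)
  hence e: "(1 - 2 * \<beta>) * (real (r choose 2) * \<mu>\<^sup>2) \<le> e" using AB by (simp add: mult_le_cancel_left)
  have r2: "2 * real (r choose 2) = real r * (real r - 1)"
  proof -
    have "even (r * (r - 1))" by (cases r) auto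
    hence "2 * (r choose 2) = r * (r - 1)" by (simp add: choose_two)
    hence "real (2 * (r choose 2)) = real (r * (r - 1))" by (simp only:)
    thus ?thesis using r by simp
  qed
  \<comment> \<open>Origin of the 64: the loss in \<open>2 * e\<close> is
    \<open>4 * (r choose 2)\<close> times \<open>\<beta> * \<mu> ^ 2\<close>, and the latter is at
    most \<open>4 * (\<beta> * \<mu>' ^ 2) = 16 * 4 ^ m\<close>.\<close>
  have "\<mu>\<^sup>2 \<le> (2 * \<mu>')\<^sup>2" using \<mu>2 \<mu>pos by (intro power_mono) auto
  hence "\<beta> * \<mu>\<^sup>2 \<le> \<beta> * (2 * \<mu>')\<^sup>2" by (intro mult_left_mono) (auto simp: \<beta>_def)
  also have "\<dots> = 16 * 4 ^ m" using \<mu>pos by (simp add: \<beta>_def power_divide power_mult_distrib)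
  finally have "4 * real (r choose 2) * (\<beta> * \<mu>\<^sup>2) \<le> 4 * real (r choose 2) * (16 * 4 ^ m)"
    by (intro mult_left_mono) auto
  hence "4 * real (r choose 2) * (\<beta> * \<mu>\<^sup>2) \<le> C" by (simp add: C_def)
  moreover have "2 * real (r choose 2) * \<mu>\<^sup>2 = (1 - 1 / real r) * real n ^ 2"
    unfolding r2 \<mu>_def using r by (simp add: field_simps power2_eq_square)
  moreover have "2 * ((1 - 2 * \<beta>) * (real (r choose 2) * \<mu>\<^sup>2)) =
      2 * real (r choose 2) * \<mu>\<^sup>2 - 4 * real (r choose 2) * (\<beta> * \<mu>\<^sup>2)" by (simp add: algebra_simps)
  ultimately have "2 * e \<ge> (1 - 1 / real r) * real n ^ 2 - C" using e by linarith
  hence "cnt V V (adj E) \<ge> (1 - 1 / real r) * real (card V) ^ 2 - C"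
    using cnt_adj_cliques[OF V, of E] by (simp add: e_def n_def)
  then obtain c :: "'a \<Rightarrow> nat" where c: "\<forall>v\<in>V. c v < r" "\<forall>x\<in>V. \<forall>y\<in>V. adj E x y \<longrightarrow> c x \<noteq> c y"
    using proper_colouring[OF V free r(1), of C] C64 \<mu>C unfolding \<mu>_def n_def by auto
  have "real (card (clique_pairs E V l m)) \<le> Phi r l m (\<lambda>i. card {v\<in>V. c v = i})"
    by (rule clique_pairs_le_Phi_proper[OF V c])
  also have "\<dots> \<le> Phi r l m t"
  proof (rule Phi_le_balanced)
    have "real (\<Sum>i<r. card {v\<in>V. c v = i}) = real (card V)" using cnt_cross(2)[OF V c(1)] by simp
    thus "(\<Sum>i<r. card {v\<in>V. c v = i}) = (\<Sum>i<r. t i)" unfolding sum of_nat_eq_iff .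
  qed (rule bal)
  finally show False using gt by simp
qed

subsection \<open>Copies of two disjoint cliques\<close>

lemma pairs_image:
  assumes "inj_on f A"
  shows "(\<lambda>e. f ` e) ` {e. e \<subseteq> A \<and> card e = 2} = {e. e \<subseteq> f ` A \<and> card e = 2}"
proof (intro equalityI subsetI)
  fix e assume "e \<in> (\<lambda>e. f ` e) ` {e. e \<subseteq> A \<and> card e = 2}"
  then obtain d where "e = f ` d" "d \<subseteq> A" "card d = 2" by blast
  thus "e \<in> {e. e \<subseteq> f ` A \<and> card e = 2}"
    using assms by (auto simp: card_image inj_on_subset)
next
  fix e assume "e \<in> {e. e \<subseteq> f ` A \<and> card e = 2}"
  then obtain d where "d \<subseteq> A" "e = f ` d" "card e = 2" by (auto simp: subset_image_iff)
  moreover from this have "card d = 2" using assms by (metis card_image inj_on_subset)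
  ultimately show "e \<in> (\<lambda>e. f ` e) ` {e. e \<subseteq> A \<and> card e = 2}" by blast
qed

lemma simple_complete_graph: "finite A \<Longrightarrow> simple_graph (complete_graph A)"
  by (auto simp: simple_graph_def complete_graph_def)

lemma simple_graph_union: "simple_graph G \<Longrightarrow> simple_graph H \<Longrightarrow> simple_graph (graph_union G H)"
  by (auto simp: simple_graph_def graph_union_def)

text \<open>A copy comes with a map from \<open>S\<close> to \<open>H\<close>, whereas cliques of
  \<open>H\<close> have to be carried into the host graph. Edges of the simple graph
  \<open>S\<close> lie inside its vertex set, so \<open>inv_into\<close> undoes \<open>f\<close> on
  each of them.\<close>

lemma isomorphic_sym:
  assumes "simple_graph S" "isomorphic S H"
  shows "isomorphic H S"
proof -
  obtain f where f: "bij_betw f (verts S) (verts H)" and e: "edges H = (\<lambda>e. f ` e) ` edges S"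
    using assms(2) by (auto simp: isomorphic_def)
  define g where "g = inv_into (verts S) f"
  have "g ` f ` d = d" if "d \<in> edges S" for d
    using that assms(1) f by (auto simp: g_def simple_graph_def bij_betw_def inv_into_image_cancel)
  hence "(\<lambda>e. g ` e) ` edges H = edges S" unfolding e by (simp add: image_image)
  moreover have "bij_betw g (verts H) (verts S)" unfolding g_def by (rule bij_betw_inv_into[OF f])
  ultimately show ?thesis unfolding isomorphic_def by metis
qed

lemma mem_cliques_iff_pairs:
  "Q \<in> cliques E V j \<longleftrightarrow> Q \<subseteq> V \<and> card Q = j \<and> {e. e \<subseteq> Q \<and> card e = 2} \<subseteq> E"
proof -
  have "(\<forall>x\<in>Q. \<forall>y\<in>Q. x \<noteq> y \<longrightarrow> {x, y} \<in> E) \<longleftrightarrow> {e. e \<subseteq> Q \<and> card e = 2} \<subseteq> E"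
  proof
    assume "\<forall>x\<in>Q. \<forall>y\<in>Q. x \<noteq> y \<longrightarrow> {x, y} \<in> E"
    thus "{e. e \<subseteq> Q \<and> card e = 2} \<subseteq> E" by (auto simp: card_2_iff)
  next
    assume sub: "{e. e \<subseteq> Q \<and> card e = 2} \<subseteq> E"
    have "{x, y} \<in> E" if "x \<in> Q" "y \<in> Q" "x \<noteq> y" for x y
      using that by (intro subsetD[OF sub]) auto
    thus "\<forall>x\<in>Q. \<forall>y\<in>Q. x \<noteq> y \<longrightarrow> {x, y} \<in> E" by blast
  qed
  thus ?thesis unfolding cliques_def by simp
qed

lemma free_of_K_iff:
  assumes G: "simple_graph G"
  shows "free_of (K k) G \<longleftrightarrow> cliques (edges G) (verts G) k = {}"
proof
  have V: "finite (verts G)" using G by (simp add: simple_graph_def)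
  assume free: "free_of (K k) G"
  show "cliques (edges G) (verts G) k = {}"
  proof (rule ccontr)
    assume "cliques (edges G) (verts G) k \<noteq> {}"
    then obtain Q where "Q \<in> cliques (edges G) (verts G) k" by blast
    hence Q: "Q \<subseteq> verts G" "card Q = k" "{e. e \<subseteq> Q \<and> card e = 2} \<subseteq> edges G"
      unfolding mem_cliques_iff_pairs by simp_all
    have fin: "finite Q" using Q(1) V finite_subset by blast
    obtain f where f: "bij_betw f Q {..<k}"
      using ex_bij_betw_finite_nat[OF fin] Q(2) by (auto simp: atLeast0LessThan)
    have "isomorphic (complete_graph Q) (K k)"
      using f pairs_image[of f Q] unfolding isomorphic_def complete_graph_def
      by (intro exI[of _ f]) (auto simp: bij_betw_def)
    moreover have "subgraph (complete_graph Q) G"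
      using Q simple_complete_graph[OF fin] by (simp add: subgraph_def complete_graph_def)
    ultimately show False using free unfolding free_of_def copies_def by blast
  qed
next
  assume no: "cliques (edges G) (verts G) k = {}"
  show "free_of (K k) G"
  proof (rule ccontr)
    assume "\<not> free_of (K k) G"
    then obtain S where S: "subgraph S G" "isomorphic S (K k)" unfolding free_of_def copies_def by blast
    hence "isomorphic (K k) S" by (auto simp: subgraph_def intro: isomorphic_sym)
    then obtain g where g: "bij_betw g {..<k} (verts S)"
      and e: "edges S = (\<lambda>e. g ` e) ` {e. e \<subseteq> {..<k} \<and> card e = 2}"
      unfolding isomorphic_def complete_graph_def by auto
    have "edges S = {e. e \<subseteq> verts S \<and> card e = 2}"
      using e pairs_image[of g "{..<k}"] g by (simp add: bij_betw_def)
    moreover have "card (verts S) = k" using bij_betw_same_card[OF g] by simp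
    ultimately have "verts S \<in> cliques (edges G) (verts G) k"
      using S(1) unfolding mem_cliques_iff_pairs by (simp add: subgraph_def)
    thus False using no by blast
  qed
qed

text \<open>Otherwise some \<open>x\<close> outside \<open>L\<close> and some \<open>y\<close>
  outside \<open>M\<close> would be joined by an edge lying in neither part. This yields both the
  absence of large cliques in the pattern and the recovery of its two cliques from a copy.\<close>

lemma clique_in_disjoint_union:
  assumes "Q \<subseteq> L \<union> M" "L \<inter> M = {}"
    and "{e. e \<subseteq> Q \<and> card e = 2} \<subseteq> {e. e \<subseteq> L \<and> card e = 2} \<union> {e. e \<subseteq> M \<and> card e = 2}"
  shows "Q \<subseteq> L \<or> Q \<subseteq> M"
proof (rule ccontr)
  assume "\<not> ?thesis"
  then obtain x y where xy: "x \<in> Q" "x \<notin> L" "y \<in> Q" "y \<notin> M" by blast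
  hence "x \<noteq> y" using assms by blast
  hence "{x, y} \<in> {e. e \<subseteq> Q \<and> card e = 2}" using xy by auto
  hence "{x, y} \<subseteq> L \<or> {x, y} \<subseteq> M" using assms(3) by blast
  thus False using xy by blast
qed

lemma two_cliques_free:
  assumes "finite A" "card A = l" "finite B" "card B = m" "A \<inter> B = {}" "l \<le> m" "m < k"
  shows "free_of (K k) (graph_union (complete_graph A) (complete_graph B))" (is "free_of _ ?H")
proof -
  have simple: "simple_graph ?H" using assms by (intro simple_graph_union simple_complete_graph)
  have "cliques (edges ?H) (verts ?H) k = {}"
  proof (rule ccontr)
    assume "\<not> ?thesis"
    then obtain Q where "Q \<in> cliques (edges ?H) (verts ?H) k" by blast
    hence Q: "Q \<subseteq> A \<union> B" "card Q = k"
      "{e. e \<subseteq> Q \<and> card e = 2} \<subseteq> {e. e \<subseteq> A \<and> card e = 2} \<union> {e. e \<subseteq> B \<and> card e = 2}"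
      unfolding mem_cliques_iff_pairs by (simp_all add: graph_union_def complete_graph_def)
    have "Q \<subseteq> A \<or> Q \<subseteq> B" by (rule clique_in_disjoint_union[OF Q(1) assms(5) Q(3)])
    hence "k \<le> m" using assms Q(2) card_mono[of A Q] card_mono[of B Q] by auto
    thus False using assms by simp
  qed
  thus ?thesis using free_of_K_iff[OF simple] by simp
qed

lemma isomorphic_two_cliques:
  assumes "finite A" "finite B" "A \<inter> B = {}" "finite L" "finite M" "L \<inter> M = {}"
    and "card L = card A" "card M = card B"
  shows "isomorphic (graph_union (complete_graph L) (complete_graph M))
                    (graph_union (complete_graph A) (complete_graph B))"
proof -
  obtain f where f: "bij_betw f L A" using assms finite_same_card_bij by blast
  obtain g where g: "bij_betw g M B" using assms finite_same_card_bij by blast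
  define h where "h x = (if x \<in> L then f x else g x)" for x
  have hL: "bij_betw h L A" using f by (auto simp: h_def cong: bij_betw_cong)
  have "bij_betw h M B \<longleftrightarrow> bij_betw g M B"
    using assms(6) by (intro bij_betw_cong) (auto simp: h_def)
  hence hM: "bij_betw h M B" using g by simp
  have "bij_betw h (L \<union> M) (A \<union> B)" by (rule bij_betw_combine[OF hL hM assms(3)])
  thus ?thesis
    using pairs_image[of h L] pairs_image[of h M] hL hM
    unfolding isomorphic_def graph_union_def complete_graph_def
    by (intro exI[of _ h]) (auto simp: bij_betw_def image_Un)
qed

lemma copies_two_cliques:
  assumes G: "simple_graph G" and A: "finite A" "card A = l" and B: "finite B" "card B = m"
    and AB: "A \<inter> B = {}"
  shows "copies (graph_union (complete_graph A) (complete_graph B)) G =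
     (\<lambda>(L, M). graph_union (complete_graph L) (complete_graph M)) ` clique_pairs (edges G) (verts G) l m"
    (is "copies ?H G = ?\<phi> ` ?P")
proof (intro equalityI subsetI)
  have V: "finite (verts G)" using G by (simp add: simple_graph_def)
  {
    fix S assume "S \<in> copies ?H G"
    hence S: "simple_graph S" "verts S \<subseteq> verts G" "edges S \<subseteq> edges G" "isomorphic S ?H"
      by (auto simp: copies_def subgraph_def)
    obtain g where g: "bij_betw g (A \<union> B) (verts S)" and e: "edges S = (\<lambda>e. g ` e) `
        ({e. e \<subseteq> A \<and> card e = 2} \<union> {e. e \<subseteq> B \<and> card e = 2})"
      using isomorphic_sym[OF S(1,4)] by (auto simp: isomorphic_def complete_graph_def graph_union_def)
    have inj: "inj_on g A" "inj_on g B" and vS: "verts S = g ` A \<union> g ` B"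
      using g by (auto simp: bij_betw_def inj_on_Un image_Un)
    have disj: "g ` A \<inter> g ` B = {}"
      using g AB inj_on_image_Int[of g "A \<union> B" A B] by (simp add: bij_betw_def)
    have eS: "edges S = {e. e \<subseteq> g ` A \<and> card e = 2} \<union> {e. e \<subseteq> g ` B \<and> card e = 2}"
      unfolding e image_Un pairs_image[OF inj(1)] pairs_image[OF inj(2)] ..
    have "S = ?\<phi> (g ` A, g ` B)"
      using vS eS by (cases S) (simp add: graph_union_def complete_graph_def)
    moreover have "g ` A \<in> cliques (edges G) (verts G) l" "g ` B \<in> cliques (edges G) (verts G - g ` A) m"
      using S(2,3) vS eS disj A B inj unfolding mem_cliques_iff_pairs by (auto simp: card_image)
    ultimately show "S \<in> ?\<phi> ` ?P" unfolding clique_pairs_def by blast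
  next
    fix S assume "S \<in> ?\<phi> ` ?P"
    then obtain L M where LM: "L \<in> cliques (edges G) (verts G) l" "M \<in> cliques (edges G) (verts G - L) m"
      and S: "S = graph_union (complete_graph L) (complete_graph M)"
      by (auto simp: clique_pairs_def)
    have L: "L \<subseteq> verts G" "card L = l" "{e. e \<subseteq> L \<and> card e = 2} \<subseteq> edges G"
      using LM(1) unfolding mem_cliques_iff_pairs by simp_all
    have M: "M \<subseteq> verts G" "L \<inter> M = {}" "card M = m" "{e. e \<subseteq> M \<and> card e = 2} \<subseteq> edges G"
      using LM(2) unfolding mem_cliques_iff_pairs by auto
    have fin: "finite L" "finite M" using L(1) M(1) V finite_subset by blast+
    have "subgraph S G"
      unfolding subgraph_def S
      using simple_graph_union[OF simple_complete_graph[OF fin(1)] simple_complete_graph[OF fin(2)]] L M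
      by (auto simp: graph_union_def complete_graph_def)
    moreover have "isomorphic S ?H"
      unfolding S using A B AB fin L M by (intro isomorphic_two_cliques) auto
    ultimately show "S \<in> copies ?H G" by (simp add: copies_def)
  }
qed

text \<open>A copy determines its two cliques up to order. The order is forced by the sizes when
  \<open>l < m\<close> and is free when \<open>l = m\<close>, hence the factor 2.\<close>

lemma card_clique_pairs:
  assumes G: "simple_graph G" and A: "finite A" "card A = l" and B: "finite B" "card B = m"
    and AB: "A \<inter> B = {}" and lm: "0 < l" "l \<le> m"
  shows "card (clique_pairs (edges G) (verts G) l m) =
     (if l = m then 2 else 1) * num_copies (graph_union (complete_graph A) (complete_graph B)) G"
proof -
  define P where "P = clique_pairs (edges G) (verts G) l m"
  define \<phi> :: "'a set \<times> 'a set \<Rightarrow> 'a sgraph"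
    where "\<phi> = (\<lambda>(L, M). graph_union (complete_graph L) (complete_graph M))"
  have V: "finite (verts G)" using G by (simp add: simple_graph_def)
  have PD: "finite L \<and> finite M \<and> card L = l \<and> card M = m \<and> L \<inter> M = {}" if "(L, M) \<in> P" for L M
    using that V by (auto simp: P_def clique_pairs_def cliques_def dest: finite_subset)
  have fibre: "card {p \<in> P. \<phi> p = \<phi> (L, M)} = (if l = m then 2 else 1)" if LM: "(L, M) \<in> P" for L M
  proof -
    note D = PD[OF LM]
    have "{p \<in> P. \<phi> p = \<phi> (L, M)} = (if l = m then {(L, M), (M, L)} else {(L, M)})"
    proof (intro equalityI subsetI)
      fix p assume p: "p \<in> {p \<in> P. \<phi> p = \<phi> (L, M)}"
      obtain L' M' where [simp]: "p = (L', M')" by (cases p)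
      have D': "finite L' \<and> finite M' \<and> card L' = l \<and> card M' = m \<and> L' \<inter> M' = {}" using p PD[of L' M'] by simp
      have un: "L' \<union> M' = L \<union> M"
        and pr: "{e. e \<subseteq> L' \<and> card e = 2} \<union> {e. e \<subseteq> M' \<and> card e = 2} =
          {e. e \<subseteq> L \<and> card e = 2} \<union> {e. e \<subseteq> M \<and> card e = 2}"
        using p by (auto simp: \<phi>_def graph_union_def complete_graph_def)
      \<comment> \<open>Equal edge sets make \<open>L'\<close> and \<open>M'\<close> cliques of the
        union of the complete graphs on \<open>L\<close> and \<open>M\<close>, so each lies in one
        part.\<close>
      have "L' \<subseteq> L \<or> L' \<subseteq> M" "M' \<subseteq> L \<or> M' \<subseteq> M"
        using clique_in_disjoint_union[OF _ _ equalityD1[OF pr, THEN order.trans[OF Un_upper1]]]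
          clique_in_disjoint_union[OF _ _ equalityD1[OF pr, THEN order.trans[OF Un_upper2]]] un D by blast+
      then consider "L' \<subseteq> L" | "L' \<subseteq> M" "M' \<subseteq> L" | "L' \<subseteq> M" "M' \<subseteq> M" by blast
      thus "p \<in> (if l = m then {(L, M), (M, L)} else {(L, M)})"
      proof cases
        case 1
        hence "L' = L" using D D' by (simp add: card_subset_eq)
        moreover from this have "M' = M" using un D D' by blast
        ultimately show ?thesis by simp
      next
        case 2
        hence "m \<le> l" using D D' card_mono[of L M'] by simp
        hence "l = m" using lm by simp
        hence "L' = M" "M' = L" using 2 D D' by (simp_all add: card_subset_eq)
        thus ?thesis using \<open>l = m\<close> by simp
      next
        case 3
        \<comment> \<open>Two cliques inside \<open>M\<close> would leave \<open>L\<close>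
          uncovered.\<close>
        hence "L = {}" using un D by blast
        thus ?thesis using D lm by simp
      qed
    next
      fix p assume p: "p \<in> (if l = m then {(L, M), (M, L)} else {(L, M)})"
      have "(M, L) \<in> P" if "l = m"
        using LM that by (auto simp: P_def clique_pairs_def cliques_def)
      moreover have "\<phi> (M, L) = \<phi> (L, M)" by (auto simp: \<phi>_def graph_union_def)
      ultimately show "p \<in> {p \<in> P. \<phi> p = \<phi> (L, M)}" using p LM by (auto split: if_splits)
    qed
    moreover have "L \<noteq> M" using D lm by auto
    ultimately show ?thesis by simp
  qed
  have "card P = (\<Sum>p\<in>P. 1)" by simp
  also have "\<dots> = (\<Sum>S\<in>\<phi> ` P. \<Sum>p\<in>{p \<in> P. \<phi> p = S}. 1)"
    by (rule sum.image_gen) (simp add: P_def finite_clique_pairs V)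
  also have "\<dots> = (\<Sum>S\<in>\<phi> ` P. (if l = m then 2 else 1))"
    using fibre by (intro sum.cong refl) auto
  also have "\<dots> = (if l = m then 2 else 1) * card (\<phi> ` P)" by simp
  also have "\<phi> ` P = copies (graph_union (complete_graph A) (complete_graph B)) G"
    unfolding P_def \<phi>_def using copies_two_cliques[OF G A B AB] by simp
  finally show ?thesis by (simp add: P_def num_copies_def)
qed

text \<open>Disjoint classes that cover the vertex set amount to a colouring, the form in which
  transversals and class sizes are stated. Simplicity follows because vertices of different classes
  are distinct.\<close>

lemma turan_graph_colouring:
  assumes T: "is_turan_graph r n T"
  obtains c :: "'a \<Rightarrow> nat" where "\<forall>v\<in>verts T. c v < r"
    "\<And>x y. x \<in> verts T \<Longrightarrow> y \<in> verts T \<Longrightarrow> {x, y} \<in> edges T \<longleftrightarrow> c x \<noteq> c y"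
    "\<And>i. i < r \<Longrightarrow> int (card {v\<in>verts T. c v = i}) = \<lceil>real n / real r\<rceil> \<or>
                   int (card {v\<in>verts T. c v = i}) = \<lfloor>real n / real r\<rfloor>"
    "simple_graph T"
proof -
  from T[unfolded is_turan_graph_def, THEN conjunct2, THEN conjunct2]
  obtain A where A: "disjoint_family_on A {..<r} \<and> (\<Union>i<r. A i) = verts T \<and>
    (\<forall>i<r. int (card (A i)) = \<lceil>real n / real r\<rceil> \<or> int (card (A i)) = \<lfloor>real n / real r\<rfloor>) \<and>
    edges T = {{u, v} | u v. \<exists>i<r. \<exists>j<r. i \<noteq> j \<and> u \<in> A i \<and> v \<in> A j}"
    by (rule exE)
  note disj = A[THEN conjunct1] and un = A[THEN conjunct2, THEN conjunct1]
    and sz = A[THEN conjunct2, THEN conjunct2, THEN conjunct1]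
    and E = A[THEN conjunct2, THEN conjunct2, THEN conjunct2]
  have "\<forall>v\<in>verts T. \<exists>i<r. v \<in> A i" using un by blast
  then obtain c where c: "\<And>v. v \<in> verts T \<Longrightarrow> c v < r \<and> v \<in> A (c v)" by metis
  have uniq: "c v = i" if "i < r" "v \<in> A i" for v i
  proof (rule ccontr)
    assume ne: "c v \<noteq> i"
    have "v \<in> verts T" using that un by blast
    thus False using disj ne that c[of v] unfolding disjoint_family_on_def by blast
  qed
  have cls: "{v\<in>verts T. c v = i} = A i" if "i < r" for i
    using uniq[OF that] c un that by blast
  have fin: "finite (verts T)" using T by (simp add: is_turan_graph_def)
  show thesis
  proof (rule that[of c])
    show "\<forall>v\<in>verts T. c v < r" using c by blast
    show "int (card {v\<in>verts T. c v = i}) = \<lceil>real n / real r\<rceil> \<or>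
        int (card {v\<in>verts T. c v = i}) = \<lfloor>real n / real r\<rfloor>" if "i < r" for i
      using sz cls[OF that] that by simp
    show "{x, y} \<in> edges T \<longleftrightarrow> c x \<noteq> c y" if "x \<in> verts T" "y \<in> verts T" for x y
    proof
      assume "{x, y} \<in> edges T"
      then obtain u v i j where "{x, y} = {u, v}" "i < r" "j < r" "i \<noteq> j" "u \<in> A i" "v \<in> A j"
        unfolding E by blast
      moreover from this have "c u = i" "c v = j" using uniq by auto
      ultimately show "c x \<noteq> c y" by (auto simp: doubleton_eq_iff)
    next
      assume "c x \<noteq> c y"
      thus "{x, y} \<in> edges T" unfolding E using c[OF that(1)] c[OF that(2)] by blast
    qed
    show "simple_graph T"
      unfolding simple_graph_def
    proof (intro conjI ballI fin)
      fix e assume "e \<in> edges T"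
      then obtain u v i j where e: "e = {u, v}" "i < r" "j < r" "i \<noteq> j" "u \<in> A i" "v \<in> A j"
        unfolding E by blast
      show "e \<subseteq> verts T" using e un by blast
      have "u \<noteq> v" using uniq e by blast
      thus "card e = 2" using e by simp
    qed
  qed
qed

theorem proposition2p3:
  fixes l m k :: nat and A B :: "'a set"
  assumes "2 \<le> l" and "l \<le> m" and "m < k"
    and "finite A" and "card A = l"
    and "finite B" and "card B = m"
    and "A \<inter> B = {}"
  shows "turan_good k (graph_union (complete_graph A) (complete_graph B))"
proof -
  define H where "H = graph_union (complete_graph A) (complete_graph B)"
  define r where "r = k - 1"
  have k: "k = Suc r" and r: "l \<le> r" "m \<le> r" "r > 0" using assms by (auto simp: r_def)
  have "ex_num n H (K k) = num_copies H T"
    if n: "n > 3 * (64 * 4 ^ m * (r choose 2)) * r" "n \<ge> 2 * l" and T: "is_turan_graph (k - 1) n T"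
    for n and T :: "nat sgraph"
  proof -
    have T: "is_turan_graph r n T" using T by (simp add: r_def)
    obtain c where c: "\<forall>v\<in>verts T. c v < r"
      and E: "\<And>x y. x \<in> verts T \<Longrightarrow> y \<in> verts T \<Longrightarrow> {x, y} \<in> edges T \<longleftrightarrow> c x \<noteq> c y"
      and sz: "\<And>i. i < r \<Longrightarrow> int (card {v\<in>verts T. c v = i}) = \<lceil>real n / real r\<rceil> \<or>
                   int (card {v\<in>verts T. c v = i}) = \<lfloor>real n / real r\<rfloor>"
      and simple: "simple_graph T"
      by (rule turan_graph_colouring[OF T]) blast
    have V: "finite (verts T)" "card (verts T) = n" using T by (auto simp: is_turan_graph_def)
    define t where "t i = card {v\<in>verts T. c v = i}" for i
    \<comment> \<open>Stated for every \<open>W\<close>, since the second clique of a pair lives in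
      the vertex set minus the first.\<close>
    have cl: "cliques (edges T) W j = transversals c W j" if "W \<subseteq> verts T" for W j
    proof -
      have "(\<forall>x\<in>Q. \<forall>y\<in>Q. x \<noteq> y \<longrightarrow> {x, y} \<in> edges T) \<longleftrightarrow> inj_on c Q" if "Q \<subseteq> W" for Q
      proof -
        have "{x, y} \<in> edges T \<longleftrightarrow> c x \<noteq> c y" if "x \<in> Q" "y \<in> Q" for x y
          using that \<open>Q \<subseteq> W\<close> \<open>W \<subseteq> verts T\<close> by (intro E) auto
        thus ?thesis by (auto simp: inj_on_def)
      qed
      thus ?thesis unfolding cliques_def transversals_def by blast
    qed
    have pairs_T: "real (card (clique_pairs (edges T) (verts T) l m)) = Phi r l m t"
      unfolding clique_pairs_def t_def card_transversal_pairs[OF V(1) c, symmetric]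
      by (simp add: cl)
    \<comment> \<open>A \<open>k\<close>-clique would need \<open>k = r + 1\<close> colours out of
      \<open>r\<close>.\<close>
    have "L \<notin> transversals c (verts T) k" for L
    proof
      assume L: "L \<in> transversals c (verts T) k"
      hence "c ` L \<subseteq> {..<r}" using c by (auto simp: transversals_def)
      hence "card (c ` L) \<le> r" using card_mono[of "{..<r}" "c ` L"] by simp
      thus False using L k by (simp add: transversals_def card_image)
    qed
    hence "transversals c (verts T) k = {}" by blast
    hence free_T: "free_of (K k) T" using free_of_K_iff[OF simple] cl[OF order.refl] by simp
    have sum_t: "(\<Sum>i<r. t i) = n"
    proof -
      have "real (\<Sum>i<r. t i) = real n" using cnt_cross(2)[OF V(1) c] V(2) by (simp add: t_def)
      thus ?thesis by (simp only: of_nat_eq_iff)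
    qed
    define f g where "f = \<lfloor>real n / real r\<rfloor>" and "g = \<lceil>real n / real r\<rceil>"
    have t: "int (t i) = g \<or> int (t i) = f" if "i < r" for i
      using sz[OF that] unfolding t_def f_def g_def .
    have fg: "real_of_int f \<le> real n / real r" "real n / real r < real_of_int f + 1"
      "real n / real r \<le> real_of_int g" "real_of_int g - 1 < real n / real r"
      using floor_correct[of "real n / real r"] ceiling_correct[of "real n / real r"]
      unfolding f_def g_def by simp_all
    have near: "\<bar>real (t i) - real n / real r\<bar> \<le> 1" if "i < r" for i
    proof -
      have "real (t i) = real_of_int g \<or> real (t i) = real_of_int f" using t[OF that] by auto
      thus ?thesis using fg by auto
    qed
    have bal: "t i \<le> t j + 1" if "i < r" "j < r" for i j
    proof -
      \<comment> \<open>Strict inequalities between integers sharpen to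
        \<open>f \<le> g \<le> f + 1\<close>, so classes of either kind differ by at most
        one.\<close>
      have "real_of_int g < real_of_int (f + 2)" "real_of_int f < real_of_int (g + 1)" using fg by auto
      hence "g \<le> f + 1" "f \<le> g" by linarith+
      thus ?thesis using t[OF that(1)] t[OF that(2)] by auto
    qed
    have le: "num_copies H G \<le> num_copies H T"
      if G: "simple_graph G" "card (verts G) = n" "free_of (K k) G" for G :: "nat sgraph"
    proof -
      have VG: "finite (verts G)" using G by (simp add: simple_graph_def)
      have "real (card (clique_pairs (edges G) (verts G) l m)) \<le> Phi r l m t"
      proof (rule clique_pairs_le_Phi[OF VG _ assms(1,2) r(2)])
        show "cliques (edges G) (verts G) (Suc r) = {}" using free_of_K_iff[OF G(1)] G(3) k by simp
        show "\<bar>real (t i) - real (card (verts G)) / real r\<bar> \<le> 1" if "i < r" for i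
          using near[OF that] G(2) by simp
        show "t i \<le> t j + 1" if "i < r" "j < r" for i j
          using bal[OF that] .
      qed (use n G(2) sum_t in auto)
      hence "card (clique_pairs (edges G) (verts G) l m) \<le> card (clique_pairs (edges T) (verts T) l m)"
        unfolding pairs_T[symmetric] by simp
      \<comment> \<open>Pairs and copies are related by the same factor, 1 or 2, in \<open>G\<close>
        and in \<open>T\<close>, so the comparison of pairs passes to copies.\<close>
      thus ?thesis
        using assms card_clique_pairs[OF G(1), of A l B m] card_clique_pairs[OF simple, of A l B m]
        by (simp add: H_def split: if_splits)
    qed
    show ?thesis
      unfolding ex_num_def
    proof (rule Max_eqI[OF finite_ex_values])
      show "num_copies H T \<in> {num_copies H G |G :: nat sgraph. simple_graph G \<and> card (verts G) = n \<and> free_of (K k) G}"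
        using simple V(2) free_T by blast
    qed (use le in blast)
  qed
  hence "\<forall>\<^sub>F n in sequentially. \<forall>T :: nat sgraph. is_turan_graph (k - 1) n T \<longrightarrow> ex_num n H (K k) = num_copies H T"
    using eventually_conj[OF eventually_gt_at_top[of "3 * (64 * 4 ^ m * (r choose 2)) * r"] eventually_ge_at_top[of "2 * l"]]
    by (auto elim!: eventually_mono)
  moreover have "free_of (K k) H" unfolding H_def using assms by (intro two_cliques_free) auto
  ultimately show ?thesis by (simp add: turan_good_def H_def)
qed

end
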